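(* Let $q_1,q_2,q_f\in\mathbb{N}_0$ and $q:=\min(q_1,q_2)$. Let $\{\eta_1^{(i)}\}_{i=0}^{q_1}\subset[-1,1]$ and $\{\eta_2^{(i)}\}_{i=0}^{q_2}\subset[-1,1)$ be (distinct) nodes of one-dimensional Gaussian quadrature rules for the unit weight, with positive weights $\{\omega_1^{(i)}\}_{i=0}^{q_1}$, $\{\omega_2^{(i)}\}_{i=0}^{q_2}$, and let $\{\eta_f^{(i)}\}_{i=0}^{q_f}\subset[-1,1]$, $\{\omega_f^{(i)}\}_{i=0}^{q_f}\subset[0,\infty)$ be the nodes and weights of a facet quadrature rule. Assume that for each $m\in\{1,2\}$ $$\sum_{i=0}^{q_m}V(\eta_m^{(i)})\,\omega_m^{(i)}=\int_{-1}^1V(\eta)\,d\eta\qquad\text{for all }V\in\mathbb{P}_{\tau_m}([-1,1]),\quad\text{with }\tau_1\ge 2q_1,\ \tau_2\ge 2q_2,$$ and that $$\sum_{i=0}^{q_f}V(\eta_f^{(i)})\,\omega_f^{(i)}=\int_{-1}^1V(\eta)\,d\eta\qquad\text{for all }V\in\mathbb{P}_{\tau_f}([-1,1]),\quad\text{with }\tau_f\ge 2\max(q_1,q_2).$$ Then the matrices $D^{(1)},D^{(2)}\in\mathbb{R}^{N_q\times N_q}$, $N_q=(q_1+1)(q_2+1)$, given by $$D^{(1)}_{\sigma(\boldsymbol\alpha)\sigma(\boldsymbol\beta)}=\frac{2}{1-\eta_2^{(\alpha_2)}}\frac{d\ell_1^{(\beta_1)}}{d\eta_1}(\eta_1^{(\alpha_1)})\,\delta_{\alpha_2\beta_2},$$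 $$D^{(2)}_{\sigma(\boldsymbol\alpha)\sigma(\boldsymbol\beta)}=\frac{1+\eta_1^{(\alpha_1)}}{1-\eta_2^{(\alpha_2)}}\frac{d\ell_1^{(\beta_1)}}{d\eta_1}(\eta_1^{(\alpha_1)})\,\delta_{\alpha_2\beta_2}+\delta_{\alpha_1\beta_1}\frac{d\ell_2^{(\beta_2)}}{d\eta_2}(\eta_2^{(\alpha_2)}),$$ are diagonal-norm nodal SBP operators of degree $q$ on the reference triangle $\hat\Omega$, approximating $\partial/\partial\xi_1$ and $\partial/\partial\xi_2$ respectively, with respect to the nodes $\boldsymbol\xi^{(\sigma(\boldsymbol\alpha))}=\boldsymbol\chi(\eta_1^{(\alpha_1)},\eta_2^{(\alpha_2)})$ and the diagonal norm matrix $W$ with entries $W_{\sigma(\boldsymbol\alpha)\sigma(\boldsymbol\alpha)}=\tfrac12(1-\eta_2^{(\alpha_2)})\,\omega_1^{(\alpha_1)}\omega_2^{(\alpha_2)}$, and with boundary operators $$E^{(m)}=\sum_{\zeta=1}^{3}\hat n_m^{(\zeta)}\,(R^{(\zeta)})^{\mathrm T}B^{(\zeta)}R^{(\zeta)},\qquad m\in\{1,2\},$$ where the matrices $R^{(\zeta)}$, which are interpolation/extrapolation operators of degree at least $q$, and the diagonal matrices $B^{(\zeta)}$ are those defined in the context.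
   Context: Notation. $\mathbb{P}_p(\mathcal D)$ is the space of polynomials of total degree at most $p$ on $\mathcal D$; $\mathbb{N}_0=\{0,1,2,\dots\}$; $\delta_{ij}$ is the Kronecker delta. Gaussian quadrature rules. The volume rules are of Legendre type: Gauss, Gauss-Radau (one endpoint of $[-1,1]$ is a node) or Gauss-Lobatto (both endpoints are nodes), with $q_m+1$ nodes and exact for polynomials of degree $2q_m+1$, $2q_m$, $2q_m-1$, respectively. Nodal SBP operator. Let $\hat\Omega\subset\mathbb{R}^d$ be compact and connected, with distinct nodes $\boldsymbol\xi^{(1)},\dots,\boldsymbol\xi^{(N_q)}\in\hat\Omega$ and outward unit normal $\hat{\boldsymbol n}$ on $\partial\hat\Omega$. For functions $U,V:\hat\Omega\to\mathbb{R}$ let $\underline u=[U(\boldsymbol\xi^{(1)}),\dots,U(\boldsymbol\xi^{(N_q)})]^{\mathrm T}$ and $\underline v=[V(\boldsymbol\xi^{(1)}),\dots,V(\boldsymbol\xi^{(N_q)})]^{\mathrm T}$. A matrix $D^{(m)}\in\mathbb{R}^{N_q\times N_q}$ approximating $\partial/\partial\xi_m$ is a nodal SBP operator of degree $p\in\mathbb{N}_0$ if (i) $D^{(m)}\underline v=[(\partial V/\partial\xi_m)(\boldsymbol\xi^{(1)}),\dots,(\partial V/\partial\xi_m)(\boldsymbol\xi^{(N_q)})]^{\mathrm T}$ for all $V\in\mathbb{P}_p(\hat\Omega)$; (ii) $D^{(m)}=W^{-1}Q^{(m)}$ with $W$ symmetric positive-definite and $Q^{(m)}+(Q^{(m)})^{\mathrm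 T}=E^{(m)}$; (iii) for some $r\ge p$, $\underline u^{\mathrm T}E^{(m)}\underline v=\int_{\partial\hat\Omega}U(\boldsymbol\xi)V(\boldsymbol\xi)\hat n_m(\boldsymbol\xi)\,d\hat s$ for all $U,V\in\mathbb{P}_r(\hat\Omega)$. It is diagonal-norm if $W$ is diagonal. $E^{(m)}$ is called the boundary operator. Reference triangle. $\hat\Omega=\{\boldsymbol\xi\in[-1,1]^2:\xi_1+\xi_2\le0\}$, with facets $\hat\Gamma^{(1)}=\{\boldsymbol\xi\in\hat\Omega:\xi_2=-1\}$, $\hat\Gamma^{(2)}=\{\boldsymbol\xi\in\hat\Omega:\xi_1+\xi_2=0\}$, $\hat\Gamma^{(3)}=\{\boldsymbol\xi\in\hat\Omega:\xi_1=-1\}$ and outward unit normals $\hat{\boldsymbol n}^{(1)}=[0,-1]^{\mathrm T}$, $\hat{\boldsymbol n}^{(2)}=[1/\sqrt2,1/\sqrt2]^{\mathrm T}$, $\hat{\boldsymbol n}^{(3)}=[-1,0]^{\mathrm T}$. The collapsed coordinate map $\boldsymbol\chi:[-1,1]^2\to\hat\Omega$ is $\boldsymbol\chi(\eta_1,\eta_2)=[\tfrac12(1+\eta_1)(1-\eta_2)-1,\ \eta_2]^{\mathrm T}$. Lagrange bases and ordering. For $m\in\{1,2\}$ and $i\in\{0,\dots,q_m\}$, $\ell_m^{(i)}(\eta_m)=\prod_{j\in\{0,\dots,q_m\}\setminus\{i\}}\frac{\eta_m-\eta_m^{(j)}}{\eta_m^{(i)}-\eta_m^{(j)}}$. $\sigma:\{0,\dots,q_1\}\times\{0,\dots,q_2\}\to\{1,\dots,N_q\}$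 is any bijection, and $\boldsymbol\alpha=(\alpha_1,\alpha_2)$, $\boldsymbol\beta=(\beta_1,\beta_2)$ are multi-indices in its domain. Facet quadrature and facet operators. Each facet has $q_f+1$ nodes, given for $i\in\{1,\dots,q_f+1\}$ by $\boldsymbol\xi^{(1,i)}=\boldsymbol\chi(\eta_f^{(i-1)},-1)$, $\boldsymbol\xi^{(2,i)}=\boldsymbol\chi(1,\eta_f^{(i-1)})$, $\boldsymbol\xi^{(3,i)}=\boldsymbol\chi(-1,\eta_f^{(i-1)})$, with weights $\omega^{(1,i)}=\omega_f^{(i-1)}$, $\omega^{(2,i)}=\sqrt2\,\omega_f^{(i-1)}$, $\omega^{(3,i)}=\omega_f^{(i-1)}$. $B^{(\zeta)}\in\mathbb{R}^{(q_f+1)\times(q_f+1)}$ is diagonal with $B^{(\zeta)}_{ij}=\omega^{(\zeta,i)}\delta_{ij}$. The matrices $R^{(\zeta)}\in\mathbb{R}^{(q_f+1)\times N_q}$ have entries, for $i\in\{0,\dots,q_f\}$, $R^{(1)}_{i+1,\sigma(\boldsymbol\beta)}=\ell_1^{(\beta_1)}(\eta_f^{(i)})\,\ell_2^{(\beta_2)}(-1)$, $R^{(2)}_{i+1,\sigma(\boldsymbol\beta)}=\ell_1^{(\beta_1)}(1)\,\ell_2^{(\beta_2)}(\eta_f^{(i)})$, $R^{(3)}_{i+1,\sigma(\boldsymbol\beta)}=\ell_1^{(\beta_1)}(-1)\,\ell_2^{(\beta_2)}(\eta_f^{(i)})$. $R^{(\zeta)}$ is an interpolation/extrapolation operator of degree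 $r^{(\zeta)}$ if $R^{(\zeta)}\underline v=[V(\boldsymbol\xi^{(\zeta,1)}),\dots,V(\boldsymbol\xi^{(\zeta,q_f+1)})]^{\mathrm T}$ for all $V\in\mathbb{P}_{r^{(\zeta)}}(\hat\Omega)$. *)

theory Defs
  imports "HOL-Analysis.Analysis" "Jordan_Normal_Form.Matrix"
begin

(* Two types of vectors occur: points of R^d are of type real^'d, and $ is the component of such a
   point; vectors of nodal values, and matrices acting on them, have a size depending on the
   quadrature rules and are of type "real Matrix.vec" and "real mat", with indices from 0. *)
no_notation Matrix.vec_index (infixl \<open>$\<close> 100)
no_notation Matrix.scalar_prod (infix \<open>\<bullet>\<close> 70)

section \<open>Nodal summation-by-parts operators\<close>

(* Polynomials of total degree at most p in d variables, as functions on all of R^d. All the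
   properties below only use such functions, and their derivatives, at points of the domain. *)
definition poly_space :: "nat \<Rightarrow> (real^'d \<Rightarrow> real) set" where
  "poly_space p =
    {V. \<exists>c :: ('d \<Rightarrow> nat) \<Rightarrow> real.
        V = (\<lambda>x. \<Sum>\<alpha> \<in> {\<alpha>. (\<Sum>k\<in>UNIV. \<alpha> k) \<le> p}. c \<alpha> * (\<Prod>k\<in>UNIV. (x $ k) ^ \<alpha> k))}"

lemma finite_exponents: "finite {\<alpha> :: 'd::finite \<Rightarrow> nat. (\<Sum>k\<in>UNIV. \<alpha> k) \<le> p}"
proof (rule finite_subset)
  show "{\<alpha> :: 'd \<Rightarrow> nat. (\<Sum>k\<in>UNIV. \<alpha> k) \<le> p} \<subseteq> (\<Pi>\<^sub>E k\<in>UNIV. {..p})"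
    by (force intro: order_trans[OF member_le_sum])
qed (simp add: finite_PiE)

definition partial_deriv :: "'d \<Rightarrow> (real^'d \<Rightarrow> real) \<Rightarrow> real^'d \<Rightarrow> real" where
  "partial_deriv m V x = deriv (\<lambda>t. V (x + t *\<^sub>R axis m 1)) 0"

definition nodal_vec :: "nat \<Rightarrow> (nat \<Rightarrow> real^'d) \<Rightarrow> (real^'d \<Rightarrow> real) \<Rightarrow> real Matrix.vec" where
  "nodal_vec N \<xi> U = Matrix.vec N (\<lambda>i. U (\<xi> i))"

definition sym_pos_def_mat :: "nat \<Rightarrow> real mat \<Rightarrow> bool" where
  "sym_pos_def_mat N W \<longleftrightarrow>
     W \<in> carrier_mat N N \<and> transpose_mat W = W \<and>
     (\<forall>v \<in> carrier_vec N. v \<noteq> 0\<^sub>v N \<longrightarrow> scalar_prod v (W *\<^sub>v v) > 0)"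

(* The boundary of Om enters through its surface integral, surf f being the integral of f over the
   boundary, and its outward unit normal field nrm. *)
definition nodal_SBP ::
  "(real^'d) set \<Rightarrow> ((real^'d \<Rightarrow> real) \<Rightarrow> real) \<Rightarrow> (real^'d \<Rightarrow> real^'d) \<Rightarrow>
   nat \<Rightarrow> (nat \<Rightarrow> real^'d) \<Rightarrow> 'd \<Rightarrow> nat \<Rightarrow> real mat \<Rightarrow> real mat \<Rightarrow> real mat \<Rightarrow> bool" where
  "nodal_SBP Om surf nrm N \<xi> m p D W E \<longleftrightarrow>
     compact Om \<and> connected Om \<and> inj_on \<xi> {..<N} \<and> \<xi> ` {..<N} \<subseteq> Om \<and>
     D \<in> carrier_mat N N \<and> E \<in> carrier_mat N N \<and>
     (\<forall>V \<in> poly_space p. D *\<^sub>v nodal_vec N \<xi> V = nodal_vec N \<xi> (partial_deriv m V)) \<and>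
     sym_pos_def_mat N W \<and>
     (\<exists>Winv \<in> carrier_mat N N. \<exists>Q \<in> carrier_mat N N.
        inverts_mat W Winv \<and> inverts_mat Winv W \<and> D = Winv * Q \<and> Q + transpose_mat Q = E) \<and>
     (\<exists>r \<ge> p. \<forall>U \<in> poly_space r. \<forall>V \<in> poly_space r.
        scalar_prod (nodal_vec N \<xi> U) (E *\<^sub>v nodal_vec N \<xi> V) = surf (\<lambda>x. U x * V x * (nrm x $ m)))"

definition diagonal_norm_nodal_SBP ::
  "(real^'d) set \<Rightarrow> ((real^'d \<Rightarrow> real) \<Rightarrow> real) \<Rightarrow> (real^'d \<Rightarrow> real^'d) \<Rightarrow>
   nat \<Rightarrow> (nat \<Rightarrow> real^'d) \<Rightarrow> 'd \<Rightarrow> nat \<Rightarrow> real mat \<Rightarrow> real mat \<Rightarrow> real mat \<Rightarrow> bool" where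
  "diagonal_norm_nodal_SBP Om surf nrm N \<xi> m p D W E \<longleftrightarrow>
     nodal_SBP Om surf nrm N \<xi> m p D W E \<and> diagonal_mat W"

definition interp_extrap_op ::
  "nat \<Rightarrow> (nat \<Rightarrow> real^'d) \<Rightarrow> nat \<Rightarrow> (nat \<Rightarrow> real^'d) \<Rightarrow> nat \<Rightarrow> real mat \<Rightarrow> bool" where
  "interp_extrap_op N \<xi> M \<xi>f r R \<longleftrightarrow>
     R \<in> carrier_mat M N \<and>
     (\<forall>V \<in> poly_space r. R *\<^sub>v nodal_vec N \<xi> V = nodal_vec M \<xi>f V)"

section \<open>One-dimensional quadrature and Lagrange bases\<close>

definition exact_quadrature :: "nat \<Rightarrow> (nat \<Rightarrow> real) \<Rightarrow> (nat \<Rightarrow> real) \<Rightarrow> nat \<Rightarrow> bool" where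
  "exact_quadrature q \<eta> \<omega> \<tau> \<longleftrightarrow>
     (\<forall>V :: real poly. degree V \<le> \<tau> \<longrightarrow>
        (\<Sum>i=0..q. poly V (\<eta> i) * \<omega> i) = integral {-1..1} (poly V))"

(* Legendre Gauss, Gauss-Radau and Gauss-Lobatto rules with q + 1 nodes. In the last case two
   distinct nodes are required, so q > 0 and 2 * q - 1 is not truncated. *)
definition gaussian_rule :: "nat \<Rightarrow> (nat \<Rightarrow> real) \<Rightarrow> (nat \<Rightarrow> real) \<Rightarrow> bool" where
  "gaussian_rule q \<eta> \<omega> \<longleftrightarrow>
     inj_on \<eta> {0..q} \<and> \<eta> ` {0..q} \<subseteq> {-1..1} \<and>
     (exact_quadrature q \<eta> \<omega> (2 * q + 1) \<or>
      (-1 \<in> \<eta> ` {0..q} \<or> 1 \<in> \<eta> ` {0..q}) \<and> exact_quadrature q \<eta> \<omega> (2 * q) \<or>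
      (-1 \<in> \<eta> ` {0..q} \<and> 1 \<in> \<eta> ` {0..q}) \<and> exact_quadrature q \<eta> \<omega> (2 * q - 1))"

definition lagrange :: "nat \<Rightarrow> (nat \<Rightarrow> real) \<Rightarrow> nat \<Rightarrow> real \<Rightarrow> real" where
  "lagrange q \<eta> i x = (\<Prod>j \<in> {0..q} - {i}. (x - \<eta> j) / (\<eta> i - \<eta> j))"

section \<open>The reference triangle\<close>

definition ref_triangle :: "(real^2) set" where
  "ref_triangle = {\<xi>. \<xi> $ 1 \<in> {-1..1} \<and> \<xi> $ 2 \<in> {-1..1} \<and> \<xi> $ 1 + \<xi> $ 2 \<le> 0}"

definition facet :: "3 \<Rightarrow> (real^2) set" where
  "facet \<zeta> =
    (if \<zeta> = 1 then {\<xi> \<in> ref_triangle. \<xi> $ 2 = -1}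
     else if \<zeta> = 2 then {\<xi> \<in> ref_triangle. \<xi> $ 1 + \<xi> $ 2 = 0}
     else {\<xi> \<in> ref_triangle. \<xi> $ 1 = -1})"

definition facet_normal :: "3 \<Rightarrow> real^2" where
  "facet_normal \<zeta> =
    (if \<zeta> = 1 then vector [0, -1]
     else if \<zeta> = 2 then vector [1 / sqrt 2, 1 / sqrt 2]
     else vector [-1, 0])"

(* The value chosen at the three vertices, where the normal is not defined, is irrelevant to
   boundary integrals. *)
definition ref_normal :: "real^2 \<Rightarrow> real^2" where
  "ref_normal x =
    (if x \<in> facet 1 then facet_normal 1
     else if x \<in> facet 2 then facet_normal 2
     else facet_normal 3)"

definition facet_path :: "3 \<Rightarrow> real \<Rightarrow> real^2" where
  "facet_path \<zeta> =
    (if \<zeta> = 1 then linepath (vector [-1, -1]) (vector [1, -1])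
     else if \<zeta> = 2 then linepath (vector [1, -1]) (vector [-1, 1])
     else linepath (vector [-1, 1]) (vector [-1, -1]))"

definition arclength_integral :: "(real \<Rightarrow> 'a::real_normed_vector) \<Rightarrow> ('a \<Rightarrow> real) \<Rightarrow> real" where
  "arclength_integral g f = integral {0..1} (\<lambda>t. f (g t) * norm (vector_derivative g (at t)))"

definition ref_boundary_integral :: "(real^2 \<Rightarrow> real) \<Rightarrow> real" where
  "ref_boundary_integral f = (\<Sum>\<zeta>\<in>UNIV. arclength_integral (facet_path \<zeta>) f)"

lemma path_image_facet_path: "path_image (facet_path \<zeta>) = facet \<zeta>"
proof -
  have 1: "path_image (facet_path 1) = facet 1"
  proof (intro equalityI subsetI)
    fix x assume "x \<in> facet 1"
    then have "x = facet_path 1 ((x $ 1 + 1) / 2)" "(x $ 1 + 1) / 2 \<in> {0..1}"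
      by (auto simp: facet_def facet_path_def ref_triangle_def linepath_def Finite_Cartesian_Product.vec_eq_iff forall_2
          field_simps)
    then show "x \<in> path_image (facet_path 1)" unfolding path_image_def by (rule image_eqI)
  qed (auto simp: path_image_def facet_def facet_path_def ref_triangle_def linepath_def)
  have 2: "path_image (facet_path 2) = facet 2"
  proof (intro equalityI subsetI)
    fix x assume "x \<in> facet 2"
    then have "x = facet_path 2 ((x $ 2 + 1) / 2)" "(x $ 2 + 1) / 2 \<in> {0..1}"
      by (auto simp: facet_def facet_path_def ref_triangle_def linepath_def Finite_Cartesian_Product.vec_eq_iff forall_2
          field_simps)
    then show "x \<in> path_image (facet_path 2)" unfolding path_image_def by (rule image_eqI)
  qed (auto simp: path_image_def facet_def facet_path_def ref_triangle_def linepath_def)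
  have 3: "path_image (facet_path 3) = facet 3"
  proof (intro equalityI subsetI)
    fix x assume "x \<in> facet 3"
    then have "x = facet_path 3 ((1 - x $ 2) / 2)" "(1 - x $ 2) / 2 \<in> {0..1}"
      by (auto simp: facet_def facet_path_def ref_triangle_def linepath_def Finite_Cartesian_Product.vec_eq_iff forall_2
          field_simps)
    then show "x \<in> path_image (facet_path 3)" unfolding path_image_def by (rule image_eqI)
  qed (auto simp: path_image_def facet_def facet_path_def ref_triangle_def linepath_def)
  show ?thesis using exhaust_3[of \<zeta>] by (metis 1 2 3)
qed

lemma ref_triangle_convex_hull:
  "ref_triangle = convex hull {vector [-1, -1], vector [1, -1], vector [-1, 1]}"
proof (intro equalityI subsetI)
  fix x :: "real^2" assume "x \<in> ref_triangle"
  then have "0 \<le> - (x $ 1 + x $ 2) / 2" "0 \<le> (x $ 1 + 1) / 2" "0 \<le> (x $ 2 + 1) / 2"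
    "- (x $ 1 + x $ 2) / 2 + (x $ 1 + 1) / 2 + (x $ 2 + 1) / 2 = 1"
    "x = (- (x $ 1 + x $ 2) / 2) *\<^sub>R vector [-1, -1] + ((x $ 1 + 1) / 2) *\<^sub>R vector [1, -1]
       + ((x $ 2 + 1) / 2) *\<^sub>R vector [-1, 1]"
    by (auto simp: ref_triangle_def Finite_Cartesian_Product.vec_eq_iff forall_2 field_simps)
  then show "x \<in> convex hull {vector [-1, -1], vector [1, -1], vector [-1, 1]}"
    unfolding convex_hull_3 by blast
next
  fix x :: "real^2" assume "x \<in> convex hull {vector [-1, -1], vector [1, -1], vector [-1, 1]}"
  then show "x \<in> ref_triangle"
    by (auto simp: convex_hull_3 ref_triangle_def)
qed

lemma frontier_ref_triangle: "frontier ref_triangle = (\<Union>\<zeta>. facet \<zeta>)"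
proof -
  have "(\<Union>\<zeta>. facet \<zeta>) = (\<Union>\<zeta>. path_image (facet_path \<zeta>))"
    by (simp add: path_image_facet_path)
  also have "\<dots> = path_image (facet_path 1) \<union> path_image (facet_path 2) \<union> path_image (facet_path 3)"
    unfolding UNIV_3 by blast
  also have "\<dots> = frontier ref_triangle"
    unfolding ref_triangle_convex_hull
    by (simp add: frontier_of_triangle facet_path_def Un_assoc)
  finally show ?thesis by simp
qed

definition collapsed_map :: "real \<Rightarrow> real \<Rightarrow> real^2" where
  "collapsed_map \<eta>1 \<eta>2 = vector [(1 + \<eta>1) * (1 - \<eta>2) / 2 - 1, \<eta>2]"

section \<open>Tensor-product operators on the reference triangle\<close>

definition multi_indices :: "nat \<Rightarrow> nat \<Rightarrow> (nat \<times> nat) set" where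
  "multi_indices q1 q2 = {0..q1} \<times> {0..q2}"

definition num_nodes :: "nat \<Rightarrow> nat \<Rightarrow> nat" where
  "num_nodes q1 q2 = (q1 + 1) * (q2 + 1)"

(* The multi-index numbered k by the ordering sg, a bijection from the multi-indices onto
   {..<num_nodes q1 q2}. *)
definition multi_index :: "nat \<Rightarrow> nat \<Rightarrow> (nat \<times> nat \<Rightarrow> nat) \<Rightarrow> nat \<Rightarrow> nat \<times> nat" where
  "multi_index q1 q2 sg = inv_into (multi_indices q1 q2) sg"

definition volume_node ::
  "nat \<Rightarrow> nat \<Rightarrow> (nat \<times> nat \<Rightarrow> nat) \<Rightarrow> (nat \<Rightarrow> real) \<Rightarrow> (nat \<Rightarrow> real) \<Rightarrow> nat \<Rightarrow> real^2" where
  "volume_node q1 q2 sg \<eta>1 \<eta>2 k =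
    (let (\<alpha>1, \<alpha>2) = multi_index q1 q2 sg k in collapsed_map (\<eta>1 \<alpha>1) (\<eta>2 \<alpha>2))"

(* The matrix with entry F \<alpha> \<beta> in row sg \<alpha> and column sg \<beta>. *)
definition multi_mat ::
  "nat \<Rightarrow> nat \<Rightarrow> (nat \<times> nat \<Rightarrow> nat) \<Rightarrow> (nat \<times> nat \<Rightarrow> nat \<times> nat \<Rightarrow> real) \<Rightarrow> real mat" where
  "multi_mat q1 q2 sg F =
    mat (num_nodes q1 q2) (num_nodes q1 q2)
      (\<lambda>(k, l). F (multi_index q1 q2 sg k) (multi_index q1 q2 sg l))"

lemma multi_index_ordering:
  assumes "bij_betw sg (multi_indices q1 q2) {..<num_nodes q1 q2}" "\<alpha> \<in> multi_indices q1 q2"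
  shows "sg \<alpha> < num_nodes q1 q2" "multi_index q1 q2 sg (sg \<alpha>) = \<alpha>"
  using assms by (auto simp: multi_index_def bij_betw_def)

lemma multi_mat_entry:
  assumes "bij_betw sg (multi_indices q1 q2) {..<num_nodes q1 q2}"
    "\<alpha> \<in> multi_indices q1 q2" "\<beta> \<in> multi_indices q1 q2"
  shows "multi_mat q1 q2 sg F $$ (sg \<alpha>, sg \<beta>) = F \<alpha> \<beta>"
  using assms by (simp add: multi_mat_def multi_index_ordering)

definition D1_mat ::
  "nat \<Rightarrow> nat \<Rightarrow> (nat \<times> nat \<Rightarrow> nat) \<Rightarrow> (nat \<Rightarrow> real) \<Rightarrow> (nat \<Rightarrow> real) \<Rightarrow> real mat" where
  "D1_mat q1 q2 sg \<eta>1 \<eta>2 = multi_mat q1 q2 sg (\<lambda>(\<alpha>1, \<alpha>2) (\<beta>1, \<beta>2).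
     2 / (1 - \<eta>2 \<alpha>2) * deriv (lagrange q1 \<eta>1 \<beta>1) (\<eta>1 \<alpha>1) * (if \<alpha>2 = \<beta>2 then 1 else 0))"

definition D2_mat ::
  "nat \<Rightarrow> nat \<Rightarrow> (nat \<times> nat \<Rightarrow> nat) \<Rightarrow> (nat \<Rightarrow> real) \<Rightarrow> (nat \<Rightarrow> real) \<Rightarrow> real mat" where
  "D2_mat q1 q2 sg \<eta>1 \<eta>2 = multi_mat q1 q2 sg (\<lambda>(\<alpha>1, \<alpha>2) (\<beta>1, \<beta>2).
     (1 + \<eta>1 \<alpha>1) / (1 - \<eta>2 \<alpha>2) * deriv (lagrange q1 \<eta>1 \<beta>1) (\<eta>1 \<alpha>1)
       * (if \<alpha>2 = \<beta>2 then 1 else 0)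
     + (if \<alpha>1 = \<beta>1 then 1 else 0) * deriv (lagrange q2 \<eta>2 \<beta>2) (\<eta>2 \<alpha>2))"

definition W_mat ::
  "nat \<Rightarrow> nat \<Rightarrow> (nat \<times> nat \<Rightarrow> nat) \<Rightarrow> (nat \<Rightarrow> real) \<Rightarrow> (nat \<Rightarrow> real) \<Rightarrow> (nat \<Rightarrow> real) \<Rightarrow> real mat" where
  "W_mat q1 q2 sg \<eta>2 \<omega>1 \<omega>2 = multi_mat q1 q2 sg (\<lambda>(\<alpha>1, \<alpha>2) \<beta>.
     if (\<alpha>1, \<alpha>2) = \<beta> then (1 - \<eta>2 \<alpha>2) / 2 * \<omega>1 \<alpha>1 * \<omega>2 \<alpha>2 else 0)"

definition facet_node :: "(nat \<Rightarrow> real) \<Rightarrow> 3 \<Rightarrow> nat \<Rightarrow> real^2" where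
  "facet_node \<eta>f \<zeta> i =
    (if \<zeta> = 1 then collapsed_map (\<eta>f i) (-1)
     else if \<zeta> = 2 then collapsed_map 1 (\<eta>f i)
     else collapsed_map (-1) (\<eta>f i))"

definition facet_weight :: "(nat \<Rightarrow> real) \<Rightarrow> 3 \<Rightarrow> nat \<Rightarrow> real" where
  "facet_weight \<omega>f \<zeta> i = (if \<zeta> = 2 then sqrt 2 * \<omega>f i else \<omega>f i)"

definition B_mat :: "nat \<Rightarrow> (nat \<Rightarrow> real) \<Rightarrow> 3 \<Rightarrow> real mat" where
  "B_mat qf \<omega>f \<zeta> =
    mat (qf + 1) (qf + 1) (\<lambda>(i, j). if i = j then facet_weight \<omega>f \<zeta> i else 0)"

definition R_mat ::
  "nat \<Rightarrow> nat \<Rightarrow> nat \<Rightarrow> (nat \<times> nat \<Rightarrow> nat) \<Rightarrow> (nat \<Rightarrow> real) \<Rightarrow> (nat \<Rightarrow> real) \<Rightarrow> (nat \<Rightarrow> real) \<Rightarrow> 3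
   \<Rightarrow> real mat" where
  "R_mat q1 q2 qf sg \<eta>1 \<eta>2 \<eta>f \<zeta> =
    mat (qf + 1) (num_nodes q1 q2) (\<lambda>(i, l). let (\<beta>1, \<beta>2) = multi_index q1 q2 sg l in
      if \<zeta> = 1 then lagrange q1 \<eta>1 \<beta>1 (\<eta>f i) * lagrange q2 \<eta>2 \<beta>2 (-1)
      else if \<zeta> = 2 then lagrange q1 \<eta>1 \<beta>1 1 * lagrange q2 \<eta>2 \<beta>2 (\<eta>f i)
      else lagrange q1 \<eta>1 \<beta>1 (-1) * lagrange q2 \<eta>2 \<beta>2 (\<eta>f i))"

definition facet_term ::
  "nat \<Rightarrow> nat \<Rightarrow> nat \<Rightarrow> (nat \<times> nat \<Rightarrow> nat) \<Rightarrow> (nat \<Rightarrow> real) \<Rightarrow> (nat \<Rightarrow> real) \<Rightarrow> (nat \<Rightarrow> real) \<Rightarrow>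
   (nat \<Rightarrow> real) \<Rightarrow> 2 \<Rightarrow> 3 \<Rightarrow> real mat" where
  "facet_term q1 q2 qf sg \<eta>1 \<eta>2 \<eta>f \<omega>f m \<zeta> =
    (let R = R_mat q1 q2 qf sg \<eta>1 \<eta>2 \<eta>f \<zeta>
     in (facet_normal \<zeta> $ m) \<cdot>\<^sub>m (transpose_mat R * B_mat qf \<omega>f \<zeta> * R))"

definition E_mat ::
  "nat \<Rightarrow> nat \<Rightarrow> nat \<Rightarrow> (nat \<times> nat \<Rightarrow> nat) \<Rightarrow> (nat \<Rightarrow> real) \<Rightarrow> (nat \<Rightarrow> real) \<Rightarrow> (nat \<Rightarrow> real) \<Rightarrow>
   (nat \<Rightarrow> real) \<Rightarrow> 2 \<Rightarrow> real mat" where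
  "E_mat q1 q2 qf sg \<eta>1 \<eta>2 \<eta>f \<omega>f m =
     facet_term q1 q2 qf sg \<eta>1 \<eta>2 \<eta>f \<omega>f m 1 +
     facet_term q1 q2 qf sg \<eta>1 \<eta>2 \<eta>f \<omega>f m 2 +
     facet_term q1 q2 qf sg \<eta>1 \<eta>2 \<eta>f \<omega>f m 3"

end

theory Submission
  imports Defs
begin

text \<open>
  For fixed second (first) collapsed coordinate, the pull-back of a polynomial of degree p under the
  collapsed map is a polynomial of degree at most p in the other one, so one-dimensional Lagrange
  interpolation, differentiation and the chain rule give the exactness of D and R. For Q = W D
  the factor (1 - y) / 2 in W cancels the singularity of D, and Q splits into one-dimensional
  quadratures of g a b', with g = 1, 1 + x or 1 - x and Lagrange basis polynomials a, b. These
  have degree at most 2 q and are thus exact, so integration by parts yields the values at the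
  endpoints, and for the nonconstant g also mass matrices, which cancel in Q + Q^T. The same mass
  matrices come out of the facet quadrature, whence Q + Q^T = E.
\<close>

section \<open>One-dimensional Lagrange interpolation and quadrature\<close>

text \<open>The Lagrange basis as elements of \<open>real poly\<close>, the type on which degrees,
  \<open>pderiv\<close> and \<open>exact_quadrature\<close> are available.\<close>

definition lagrange_poly :: "nat \<Rightarrow> (nat \<Rightarrow> real) \<Rightarrow> nat \<Rightarrow> real poly" where
  "lagrange_poly q \<eta> i = (\<Prod>j \<in> {0..q} - {i}. [:- \<eta> j / (\<eta> i - \<eta> j), 1 / (\<eta> i - \<eta> j):])"

lemma lagrange_eq_poly: "lagrange q \<eta> i = poly (lagrange_poly q \<eta> i)"
  by (auto simp: lagrange_def lagrange_poly_def poly_prod diff_divide_distrib intro!: prod.cong)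

lemma deriv_lagrange: "deriv (lagrange q \<eta> i) x = poly (pderiv (lagrange_poly q \<eta> i)) x"
  unfolding lagrange_eq_poly by (rule DERIV_imp_deriv) simp

lemma degree_lagrange_poly:
  assumes "i \<le> q"
  shows "degree (lagrange_poly q \<eta> i) \<le> q"
proof -
  have "degree (lagrange_poly q \<eta> i) \<le> (\<Sum>j\<in>{0..q} - {i}. 1)"
    unfolding lagrange_poly_def
    by (rule order_trans[OF degree_prod_sum_le sum_mono]) auto
  also have "\<dots> = q" using assms by simp
  finally show ?thesis .
qed

lemma lagrange_node:
  assumes "inj_on \<eta> {0..q}" "i \<le> q" "j \<le> q"
  shows "lagrange q \<eta> i (\<eta> j) = (if i = j then 1 else 0)"
proof (cases "i = j")
  case True
  with assms show ?thesis
    unfolding lagrange_def by (auto intro!: prod.neutral simp: inj_on_eq_iff)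
next
  case False
  with assms have "j \<in> {0..q} - {i}" by auto
  then have "\<exists>k\<in>{0..q} - {i}. (\<eta> j - \<eta> k) / (\<eta> i - \<eta> k) = 0" by (intro bexI[of _ j]) auto
  with False show ?thesis
    unfolding lagrange_def by (simp add: prod_zero)
qed

text \<open>Both sides have degree at most q and agree at q + 1 distinct nodes. As an identity of
  polynomials it can also be differentiated, which yields the exactness of the differentiation
  matrix in \<open>sum_deriv_lagrange\<close>.\<close>

lemma lagrange_interpolation:
  assumes inj: "inj_on \<eta> {0..q}" and deg: "degree P \<le> q"
  shows "P = (\<Sum>i=0..q. Polynomial.smult (poly P (\<eta> i)) (lagrange_poly q \<eta> i))" (is "P = ?S")
proof (rule poly_eqI_degree[of "\<eta> ` {0..q}"])
  fix x assume "x \<in> \<eta> ` {0..q}"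
  then obtain j where j: "j \<le> q" "x = \<eta> j" by auto
  have "poly ?S x = (\<Sum>i=0..q. poly P (\<eta> i) * lagrange q \<eta> i (\<eta> j))"
    by (simp add: poly_sum lagrange_eq_poly j)
  also have "\<dots> = (\<Sum>i=0..q. if i = j then poly P (\<eta> i) else 0)"
    using j by (intro sum.cong) (auto simp: lagrange_node[OF inj])
  also have "\<dots> = poly P x" using j by simp
  finally show "poly P x = poly ?S x" by simp
next
  have card: "card (\<eta> ` {0..q}) = Suc q" using inj by (simp add: card_image)
  show "degree P < card (\<eta> ` {0..q})" using deg card by simp
  have "degree ?S \<le> q"
    by (rule degree_sum_le) (auto intro: order_trans[OF degree_smult_le] degree_lagrange_poly)
  then show "degree ?S < card (\<eta> ` {0..q})" using card by simp
qed

lemma sum_lagrange: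
  assumes "inj_on \<eta> {0..q}" "degree P \<le> q"
  shows "(\<Sum>i=0..q. lagrange q \<eta> i x * poly P (\<eta> i)) = poly P x"
proof -
  have "poly P x = poly (\<Sum>i=0..q. Polynomial.smult (poly P (\<eta> i)) (lagrange_poly q \<eta> i)) x"
    using lagrange_interpolation[OF assms] by simp
  then show ?thesis by (simp add: poly_sum lagrange_eq_poly mult.commute)
qed

lemma pderiv_sum: "pderiv (sum f A) = (\<Sum>x\<in>A. pderiv (f x))"
  by (induction A rule: infinite_finite_induct) (auto simp: pderiv_add)

lemma sum_deriv_lagrange:
  assumes "inj_on \<eta> {0..q}" "degree P \<le> q"
  shows "(\<Sum>i=0..q. deriv (lagrange q \<eta> i) x * poly P (\<eta> i)) = poly (pderiv P) x"
proof -
  have "poly (pderiv P) x = poly (pderiv (\<Sum>i=0..q. Polynomial.smult (poly P (\<eta> i)) (lagrange_poly q \<eta> i))) x"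
    using lagrange_interpolation[OF assms] by simp
  then show ?thesis by (simp add: poly_sum pderiv_sum pderiv_smult deriv_lagrange mult.commute)
qed

section \<open>Mass matrices and discrete integration by parts\<close>

lemma exact_quadratureD:
  assumes "exact_quadrature q \<eta> \<omega> \<tau>" "degree V \<le> \<tau>"
  shows "(\<Sum>i=0..q. poly V (\<eta> i) * \<omega> i) = integral {-1..1} (poly V)"
  using assms by (simp add: exact_quadrature_def)

text \<open>The product has degree at most 2 q, so the rule integrates it exactly, and at the nodes
  it reduces to Kronecker deltas. Thus the exact mass matrix of the Lagrange basis is diagonal and
  carries the quadrature weights.\<close>

lemma integral_lagrange_mult:
  assumes "exact_quadrature q \<eta> \<omega> \<tau>" "2 * q \<le> \<tau>" "inj_on \<eta> {0..q}" "i \<le> q" "j \<le> q"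
  shows "integral {-1..1} (poly (lagrange_poly q \<eta> i * lagrange_poly q \<eta> j)) = (if i = j then \<omega> i else 0)"
proof -
  have "degree (lagrange_poly q \<eta> i * lagrange_poly q \<eta> j) \<le> q + q"
    using assms by (intro order_trans[OF degree_mult_le] add_mono degree_lagrange_poly)
  then have "integral {-1..1} (poly (lagrange_poly q \<eta> i * lagrange_poly q \<eta> j))
    = (\<Sum>k=0..q. poly (lagrange_poly q \<eta> i * lagrange_poly q \<eta> j) (\<eta> k) * \<omega> k)"
    using assms(2) by (intro exact_quadratureD[OF assms(1), symmetric]) linarith
  also have "\<dots> = (\<Sum>k=0..q. if k = i then (if i = j then \<omega> i else 0) else 0)"
    using assms by (intro sum.cong) (auto simp: lagrange_node simp flip: lagrange_eq_poly)
  also have "\<dots> = (if i = j then \<omega> i else 0)" using assms by simp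
  finally show ?thesis .
qed

text \<open>The facet rule is exact for the same products, so it reproduces the diagonal mass matrix
  of the volume rule even when the two rules have different nodes.\<close>

lemma facet_mass_matrix:
  assumes "exact_quadrature q \<eta> \<omega> \<tau>" "2 * q \<le> \<tau>" "inj_on \<eta> {0..q}" "i \<le> q" "j \<le> q"
    and f: "exact_quadrature qf \<eta>f \<omega>f \<tau>f" "2 * q \<le> \<tau>f"
  shows "(\<Sum>k=0..qf. \<omega>f k * lagrange q \<eta> i (\<eta>f k) * lagrange q \<eta> j (\<eta>f k)) = (if i = j then \<omega> i else 0)"
proof -
  have "degree (lagrange_poly q \<eta> i * lagrange_poly q \<eta> j) \<le> q + q"
    using assms by (intro order_trans[OF degree_mult_le] add_mono degree_lagrange_poly)
  then have "(\<Sum>k=0..qf. poly (lagrange_poly q \<eta> i * lagrange_poly q \<eta> j) (\<eta>f k) * \<omega>f k)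
    = integral {-1..1} (poly (lagrange_poly q \<eta> i * lagrange_poly q \<eta> j))"
    using f(2) by (intro exact_quadratureD[OF f(1)]) linarith
  then show ?thesis
    unfolding integral_lagrange_mult[OF assms(1-5)] by (simp add: lagrange_eq_poly mult_ac)
qed

lemma has_integral_pderiv: "(poly (pderiv P) has_integral poly P 1 - poly P (-1 :: real)) {-1..1}"
proof (rule fundamental_theorem_of_calculus)
  show "(poly P has_vector_derivative poly (pderiv P) x) (at x within {-1..1})" for x :: real
    unfolding has_real_derivative_iff_has_vector_derivative[symmetric]
    by (rule has_field_derivative_at_within[OF poly_DERIV])
qed simp

lemma poly_integrable: "poly (P :: real poly) integrable_on {a..b}"
  by (intro integrable_continuous_interval continuous_intros)

text \<open>For g = 1, 1 + x and 1 - x, this is the summation-by-parts property that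
  Q inherits from the one-dimensional rules.\<close>

lemma quadrature_by_parts:
  fixes a b :: real
  defines "g \<equiv> \<lambda>x. a + b * x"
  assumes exact: "exact_quadrature q \<eta> \<omega> \<tau>" "2 * q \<le> \<tau>" and inj: "inj_on \<eta> {0..q}"
    and ij: "i \<le> q" "j \<le> q"
  shows "g (\<eta> i) * \<omega> i * deriv (lagrange q \<eta> j) (\<eta> i) + g (\<eta> j) * \<omega> j * deriv (lagrange q \<eta> i) (\<eta> j)
    = g 1 * (lagrange q \<eta> i 1 * lagrange q \<eta> j 1)
      - g (-1) * (lagrange q \<eta> i (-1) * lagrange q \<eta> j (-1))
      - b * (if i = j then \<omega> i else 0)"
proof -
  let ?P = "lagrange_poly q \<eta> i * lagrange_poly q \<eta> j" and ?G = "[:a, b:]"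
  have gG: "g x = poly ?G x" for x by (simp add: g_def mult.commute)
  have degP: "degree ?P \<le> q + q"
    using ij by (intro order_trans[OF degree_mult_le] add_mono degree_lagrange_poly)
  have "degree (?G * pderiv ?P) \<le> \<tau>"
  \<comment> \<open>The truncated subtraction in 1 + (\<open>degree ?P\<close> - 1) gives 1 for a
    constant product, which may exceed the exactness degree when q = 0; there the derivative
    vanishes.\<close>
  proof (cases "q = 0")
    case True
    then have "pderiv ?P = 0" using degP by (simp add: pderiv_eq_0_iff)
    then show ?thesis by simp
  next
    case False
    have "degree (?G * pderiv ?P) \<le> 1 + (degree ?P - 1)"
      by (rule order_trans[OF degree_mult_le]) (simp add: degree_pderiv)
    then show ?thesis using degP exact(2) False by linarith
  qed
  then have "integral {-1..1} (poly (?G * pderiv ?P))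
    = (\<Sum>k=0..q. poly (?G * pderiv ?P) (\<eta> k) * \<omega> k)"
    using exact(1) by (simp only: exact_quadrature_def)
  \<comment> \<open>After the product rule, each summand retains one undifferentiated Lagrange
    factor, which selects the node i or j.\<close>
  also have "\<dots> = (\<Sum>k=0..q. (if k = i then g (\<eta> k) * \<omega> k * deriv (lagrange q \<eta> j) (\<eta> k) else 0)
      + (if k = j then g (\<eta> k) * \<omega> k * deriv (lagrange q \<eta> i) (\<eta> k) else 0))"
  proof (intro sum.cong refl)
    fix k assume "k \<in> {0..q}"
    then have "poly (lagrange_poly q \<eta> i) (\<eta> k) = (if i = k then 1 else 0)"
      "poly (lagrange_poly q \<eta> j) (\<eta> k) = (if j = k then 1 else 0)"
      using lagrange_node[OF inj] ij by (auto simp flip: lagrange_eq_poly)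
    then show "poly (?G * pderiv ?P) (\<eta> k) * \<omega> k
      = (if k = i then g (\<eta> k) * \<omega> k * deriv (lagrange q \<eta> j) (\<eta> k) else 0)
      + (if k = j then g (\<eta> k) * \<omega> k * deriv (lagrange q \<eta> i) (\<eta> k) else 0)"
      unfolding poly_mult pderiv_mult poly_add deriv_lagrange gG by (auto simp: algebra_simps)
  qed
  also have "\<dots> = g (\<eta> i) * \<omega> i * deriv (lagrange q \<eta> j) (\<eta> i)
      + g (\<eta> j) * \<omega> j * deriv (lagrange q \<eta> i) (\<eta> j)"
    using ij by (simp add: sum.distrib)
  finally have 1: "integral {-1..1} (poly (?G * pderiv ?P)) = \<dots>" .
  \<comment> \<open>G P' = (G P)' - b P: the first term gives the endpoint values, the second the
    mass matrix.\<close>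
  have "poly (?G * pderiv ?P) = (\<lambda>x. poly (pderiv (?G * ?P)) x - b * poly ?P x)"
    unfolding pderiv_mult[of ?G] by (rule ext) (simp add: pderiv_pCons)
  then have "integral {-1..1} (poly (?G * pderiv ?P))
    = integral {-1..1} (poly (pderiv (?G * ?P))) - b * integral {-1..1} (poly ?P)"
    by (simp only: integral_diff poly_integrable integrable_on_mult_right integral_mult_right)
  then show ?thesis
    unfolding 1 integral_lagrange_mult[OF exact inj ij] integral_unique[OF has_integral_pderiv]
    by (simp only: poly_mult gG lagrange_eq_poly)
qed

section \<open>Polynomials along lines\<close>

text \<open>On a line every coordinate is a linear polynomial in t, so a monomial of total degree d
  becomes a product of d linear factors.\<close>

lemma poly_space_line:
  fixes V :: "real^'d \<Rightarrow> real"
  assumes "V \<in> poly_space p"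
  obtains P where "degree P \<le> p" "\<And>t. V (x + t *\<^sub>R b) = poly P t"
proof -
  obtain c where V: "V = (\<lambda>x. \<Sum>\<alpha> \<in> {\<alpha>. (\<Sum>k\<in>UNIV. \<alpha> k) \<le> p}. c \<alpha> * (\<Prod>k\<in>UNIV. (x $ k) ^ \<alpha> k))"
    using assms unfolding poly_space_def by auto
  define P where "P = (\<Sum>\<alpha> \<in> {\<alpha>. (\<Sum>k\<in>UNIV. \<alpha> k) \<le> p}. Polynomial.smult (c \<alpha>) (\<Prod>k\<in>UNIV. [:x $ k, b $ k:] ^ \<alpha> k))"
  show thesis
  proof
    show "degree P \<le> p"
      unfolding P_def
    proof (rule degree_sum_le[OF finite_exponents])
      fix \<alpha> :: "'d \<Rightarrow> nat" assume "\<alpha> \<in> {\<alpha>. (\<Sum>k\<in>UNIV. \<alpha> k) \<le> p}"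
      then have le: "(\<Sum>k\<in>UNIV. \<alpha> k) \<le> p" by simp
      have "degree (\<Prod>k\<in>UNIV. [:x $ k, b $ k:] ^ \<alpha> k) \<le> (\<Sum>k\<in>UNIV. \<alpha> k)"
        by (rule order_trans[OF degree_prod_sum_le sum_mono])
          (auto intro: order_trans[OF degree_power_le])
      with le show "degree (Polynomial.smult (c \<alpha>) (\<Prod>k\<in>UNIV. [:x $ k, b $ k:] ^ \<alpha> k)) \<le> p"
        by (meson degree_smult_le order_trans)
    qed
    show "V (x + t *\<^sub>R b) = poly P t" for t
      unfolding V P_def by (simp add: poly_sum poly_prod)
  qed
qed

lemma poly_space_differentiable:
  fixes V :: "real^'d \<Rightarrow> real"
  assumes "V \<in> poly_space p"
  shows "V differentiable (at x)"
proof -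
  obtain c where V: "V = (\<lambda>x. \<Sum>\<alpha> \<in> {\<alpha>. (\<Sum>k\<in>UNIV. \<alpha> k) \<le> p}. c \<alpha> * (\<Prod>k\<in>UNIV. (x $ k) ^ \<alpha> k))"
    using assms unfolding poly_space_def by auto
  have prod: "(\<lambda>x. \<Prod>k\<in>K. (x $ k) ^ \<alpha> k) differentiable (at x)" for K :: "'d set" and \<alpha>
  proof (induction K rule: infinite_finite_induct)
    case (insert k K)
    have "(\<lambda>x. (x $ k) ^ \<alpha> k) differentiable (at x)"
      by (intro differentiable_power bounded_linear_imp_differentiable bounded_linear_vec_nth)
    with insert show ?case by (simp add: differentiable_mult)
  qed auto
  show ?thesis unfolding V
    by (intro differentiable_sum differentiable_mult differentiable_const prod finite_exponents ballI)
qed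

text \<open>\<open>partial_deriv\<close> is a one-dimensional \<open>deriv\<close>. Total
  differentiability identifies it with the derivative map applied to an axis vector, and linearity
  of that map extends this to every direction b.\<close>

lemma directional_derivative:
  assumes "V \<in> poly_space p"
  shows "((\<lambda>t. V (x + t *\<^sub>R b)) has_field_derivative (\<Sum>m\<in>UNIV. b $ m * partial_deriv m V x)) (at 0)"
proof -
  obtain V' where V': "(V has_derivative V') (at x)"
    using poly_space_differentiable[OF assms] unfolding differentiable_def by blast
  interpret V': linear V' by (rule has_derivative_linear[OF V'])
  have dir: "((\<lambda>t. V (x + t *\<^sub>R v)) has_field_derivative V' v) (at 0)" for v
  proof -
    have "((\<lambda>t. x + t *\<^sub>R v) has_derivative (\<lambda>t. t *\<^sub>R v)) (at 0)"
      by (auto intro!: derivative_eq_intros)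
    from has_derivative_compose[OF this, of V V'] V'
    have "((\<lambda>t. V (x + t *\<^sub>R v)) has_derivative (\<lambda>t. V' (t *\<^sub>R v))) (at 0)" by simp
    then show ?thesis by (simp add: has_field_derivative_def V'.scale mult.commute[of _ "V' v"])
  qed
  have "V' b = (\<Sum>m\<in>UNIV. b $ m * V' (axis m 1))"
    by (subst basis_expansion[of b, symmetric]) (simp add: V'.sum V'.scale scalar_mult_eq_scaleR)
  moreover have "partial_deriv m V x = V' (axis m 1)" for m
    unfolding partial_deriv_def by (rule DERIV_imp_deriv[OF dir])
  ultimately show ?thesis using dir[of b] by simp
qed

section \<open>The collapsed coordinate map and the facets\<close>

text \<open>The collapsed map is affine in each coordinate separately. The direction vectors here
  and in the next lemma are the columns of its Jacobian.\<close>

lemma collapsed_map_add_fst: "collapsed_map (x + t) y = collapsed_map x y + t *\<^sub>R vector [(1 - y) / 2, 0]"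
  by (simp add: collapsed_map_def Finite_Cartesian_Product.vec_eq_iff forall_2 field_simps)

lemma collapsed_map_add_snd: "collapsed_map x (y + t) = collapsed_map x y + t *\<^sub>R vector [- (1 + x) / 2, 1]"
  by (simp add: collapsed_map_def Finite_Cartesian_Product.vec_eq_iff forall_2 field_simps)

lemma collapsed_poly_fst:
  assumes V: "V \<in> poly_space p"
  obtains P where "degree P \<le> p" "\<And>x. V (collapsed_map x y) = poly P x"
    "\<And>x. poly (pderiv P) x = (1 - y) / 2 * partial_deriv 1 V (collapsed_map x y)"
proof -
  let ?b = "vector [(1 - y) / 2, 0] :: real^2"
  from V obtain P where P: "degree P \<le> p" "\<And>t. V (collapsed_map 0 y + t *\<^sub>R ?b) = poly P t"
    using poly_space_line[of V p "collapsed_map 0 y" ?b] by metis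
  have eq: "V (collapsed_map x y) = poly P x" for x
    using P(2)[of x] collapsed_map_add_fst[of 0 x y] by simp
  have "poly (pderiv P) x = (1 - y) / 2 * partial_deriv 1 V (collapsed_map x y)" for x
  \<comment> \<open>Both values are the derivative of t -> P (x + t) at 0: once from the polynomial
    P, once from V along the image of the coordinate line.\<close>
  proof (rule DERIV_unique)
    show "((\<lambda>t. poly P (x + t)) has_field_derivative poly (pderiv P) x) (at 0)"
      using poly_DERIV[of P "0 + x"] unfolding DERIV_shift by (simp add: add.commute)
    show "((\<lambda>t. poly P (x + t)) has_field_derivative
        (1 - y) / 2 * partial_deriv 1 V (collapsed_map x y)) (at 0)"
      using directional_derivative[OF V, of "collapsed_map x y" ?b]
      unfolding collapsed_map_add_fst[symmetric] eq by (simp add: sum_2)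
  qed
  with P(1) eq that show thesis by blast
qed

text \<open>Increasing the second collapsed coordinate also shifts the first physical coordinate,
  whence the term with \<open>partial_deriv 1\<close>. The first summand of \<open>D2_mat\<close>
  compensates for it.\<close>

lemma collapsed_poly_snd:
  assumes V: "V \<in> poly_space p"
  obtains P where "degree P \<le> p" "\<And>y. V (collapsed_map x y) = poly P y"
    "\<And>y. poly (pderiv P) y
      = partial_deriv 2 V (collapsed_map x y) - (1 + x) / 2 * partial_deriv 1 V (collapsed_map x y)"
proof -
  let ?b = "vector [- (1 + x) / 2, 1] :: real^2"
  from V obtain P where P: "degree P \<le> p" "\<And>t. V (collapsed_map x 0 + t *\<^sub>R ?b) = poly P t"
    using poly_space_line[of V p "collapsed_map x 0" ?b] by metis
  have eq: "V (collapsed_map x y) = poly P y" for y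
    using P(2)[of y] collapsed_map_add_snd[of x 0 y] by simp
  have rearrange: "- (1 + x) / 2 * d1 + 1 * d2 = d2 - (1 + x) / 2 * d1" for d1 d2 :: real
    by (simp add: field_simps)
  have "poly (pderiv P) y
      = partial_deriv 2 V (collapsed_map x y) - (1 + x) / 2 * partial_deriv 1 V (collapsed_map x y)" for y
  proof (rule DERIV_unique)
    show "((\<lambda>t. poly P (y + t)) has_field_derivative poly (pderiv P) y) (at 0)"
      using poly_DERIV[of P "0 + y"] unfolding DERIV_shift by (simp add: add.commute)
    show "((\<lambda>t. poly P (y + t)) has_field_derivative partial_deriv 2 V (collapsed_map x y)
        - (1 + x) / 2 * partial_deriv 1 V (collapsed_map x y)) (at 0)"
      using directional_derivative[OF V, of "collapsed_map x y" ?b]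
      unfolding collapsed_map_add_snd[symmetric] eq sum_2 vector_2 rearrange .
  qed
  with P(1) eq that show thesis by blast
qed

section \<open>Facets and boundary integrals\<close>

text \<open>Each facet is the image of a coordinate line, parametrized over [-1, 1] by the variable
  of the facet rule.\<close>

definition facet_point :: "3 \<Rightarrow> real \<Rightarrow> real^2" where
  "facet_point \<zeta> s =
    (if \<zeta> = 1 then collapsed_map s (-1)
     else if \<zeta> = 2 then collapsed_map 1 s
     else collapsed_map (-1) s)"

lemma facet_node_eq: "facet_node \<eta>f \<zeta> i = facet_point \<zeta> (\<eta>f i)"
  by (simp add: facet_node_def facet_point_def)

lemma facet_poly:
  assumes "V \<in> poly_space p"
  obtains P where "degree P \<le> p" "\<And>s. V (facet_point \<zeta> s) = poly P s"
proof (cases "\<zeta> = 1")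
  case True
  then show ?thesis using that collapsed_poly_fst[OF assms] by (metis facet_point_def)
next
  case False
  then show ?thesis using that collapsed_poly_snd[OF assms] by (metis facet_point_def)
qed

text \<open>The third facet is traversed downwards, hence the reversed parametrization.\<close>

lemma facet_path_eq:
  "facet_path \<zeta> t = facet_point \<zeta> ((if \<zeta> = 3 then -2 else 2) * t + (if \<zeta> = 3 then 1 else -1))"
  using exhaust_3[of \<zeta>]
  by (auto simp: facet_path_def facet_point_def collapsed_map_def linepath_def
      Finite_Cartesian_Product.vec_eq_iff forall_2 field_simps)

text \<open>The speed of a \<open>linepath\<close> is the length of its segment: 2 for the legs and
  sqrt 8 for the hypotenuse. The factor 2 is kept apart because it cancels against the substitution
  from [0, 1] to [-1, 1]; the rest is the factor in \<open>facet_weight\<close>.\<close>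

lemma norm_vector_derivative_facet_path:
  "norm (vector_derivative (facet_path \<zeta>) (at t)) = 2 * (if \<zeta> = 2 then sqrt 2 else 1)"
proof -
  have "sqrt 8 = 2 * sqrt 2" using real_sqrt_mult[of 4 2] by simp
  then show ?thesis
    using exhaust_3[of \<zeta>] by (auto simp: facet_path_def norm_vec_def L2_set_def sum_2)
qed

text \<open>The endpoints are excluded because two facets meet there and \<open>ref_normal\<close>
  picks one of the two normals.\<close>

lemma ref_normal_facet_path:
  assumes "0 < t" "t < 1"
  shows "ref_normal (facet_path \<zeta> t) = facet_normal \<zeta>"
  using exhaust_3[of \<zeta>] assms
  by (auto simp: ref_normal_def facet_def facet_path_def ref_triangle_def linepath_def)

lemma arclength_integral_facet:
  assumes P: "\<And>s. f (facet_point \<zeta> s) = poly P s"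
  shows "arclength_integral (facet_path \<zeta>) (\<lambda>x. f x * (ref_normal x $ m))
    = facet_normal \<zeta> $ m * ((if \<zeta> = 2 then sqrt 2 else 1) * integral {-1..1} (poly P))"
proof -
  let ?m = "if \<zeta> = 3 then -2 else 2 :: real" and ?c = "if \<zeta> = 3 then 1 else -1 :: real"
  let ?L = "if \<zeta> = 2 then sqrt 2 else 1"
  have "(poly P has_integral integral {-1..1} (poly P)) (cbox (-1) 1)"
    using poly_integrable by (simp add: integrable_integral)
  \<comment> \<open>The affine substitution divides by the absolute value of the slope, which is 2
    for either orientation.\<close>
  note has_integral_affinity[OF this, of ?m ?c]
  moreover have "(\<lambda>x. (1 / ?m) *\<^sub>R x + - ((1 / ?m) *\<^sub>R ?c)) ` cbox (-1) 1 = {0..1}"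
    using image_affinity_atLeastAtMost[of "1 / ?m" "- (1 / ?m * ?c)" "-1" 1] by (auto split: if_splits)
  ultimately
  have "((\<lambda>t. poly P (?m * t + ?c)) has_integral integral {-1..1} (poly P) / 2) {0..1}"
    by (auto split: if_splits)
  from has_integral_mult_right[OF this, of "facet_normal \<zeta> $ m * (2 * ?L)"]
  have "((\<lambda>t. f (facet_path \<zeta> t) * (facet_normal \<zeta> $ m) * (2 * ?L))
      has_integral facet_normal \<zeta> $ m * (?L * integral {-1..1} (poly P))) {0..1}"
    by (simp add: facet_path_eq P mult_ac cong: if_cong)
  \<comment> \<open>The integrands can differ only at the two vertices, a finite set that does not
    affect the integral.\<close>
  then have "((\<lambda>t. f (facet_path \<zeta> t) * (ref_normal (facet_path \<zeta> t) $ m)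
        * norm (vector_derivative (facet_path \<zeta>) (at t)))
      has_integral facet_normal \<zeta> $ m * (?L * integral {-1..1} (poly P))) {0..1}"
    by (rule has_integral_spike_finite[of "{0, 1}", rotated 2])
      (auto simp: ref_normal_facet_path norm_vector_derivative_facet_path)
  then show ?thesis
    unfolding arclength_integral_def by (rule integral_unique)
qed

lemma collapsed_map_in_ref_triangle:
  assumes "-1 \<le> x" "x \<le> 1" "-1 \<le> y" "y \<le> 1"
  shows "collapsed_map x y \<in> ref_triangle"
proof -
  have "0 \<le> (1 + x) * (1 - y)" "(1 + x) * (1 - y) \<le> 2 * (1 - y)"
    using assms mult_right_mono[of "1 + x" 2 "1 - y"] by auto
  then show ?thesis using assms by (simp add: collapsed_map_def ref_triangle_def)
qed

text \<open>The map collapses the edge y = 1 to the vertex (-1, 1). Away from it the factor 1 - y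
  can be cancelled.\<close>

lemma collapsed_map_eqD:
  assumes "collapsed_map x y = collapsed_map x' y'" "y \<noteq> 1"
  shows "x = x'" "y = y'"
  using assms by (auto simp: collapsed_map_def Finite_Cartesian_Product.vec_eq_iff forall_2)

lemma compact_ref_triangle: "compact ref_triangle"
  unfolding ref_triangle_convex_hull by (intro finite_imp_compact_convex_hull) simp

lemma connected_ref_triangle: "connected ref_triangle"
  unfolding ref_triangle_convex_hull by (intro convex_connected convex_convex_hull)

section \<open>Tensor-product operators\<close>

lemma mat_diag_mult_vec:
  assumes "v \<in> carrier_vec n"
  shows "mat_diag n w *\<^sub>v v = Matrix.vec n (\<lambda>i. (w i :: real) * vec_index v i)"
proof (rule eq_vecI)
  fix i assume "i < dim_vec (Matrix.vec n (\<lambda>i. w i * vec_index v i))"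
  then have i: "i < n" by simp
  have "vec_index (mat_diag n w *\<^sub>v v) i = (\<Sum>l\<in>{0..<n}. (if i = l then w l else 0) * vec_index v l)"
    using assms i by (simp add: mat_diag_def scalar_prod_def)
  also have "\<dots> = (\<Sum>l\<in>{0..<n}. if l = i then w i * vec_index v i else 0)"
    by (rule sum.cong) auto
  finally show "vec_index (mat_diag n w *\<^sub>v v) i = vec_index (Matrix.vec n (\<lambda>i. w i * vec_index v i)) i"
    using i by simp
qed (simp add: mat_diag_def)

lemma sym_pos_def_mat_diag:
  assumes "\<And>k. k < N \<Longrightarrow> w k > 0"
  shows "sym_pos_def_mat N (mat_diag N w)"
  unfolding sym_pos_def_mat_def
proof (intro conjI ballI impI)
  show "transpose_mat (mat_diag N w) = mat_diag N w"
    by (rule eq_matI) (auto simp: mat_diag_def)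
  fix v :: "real Matrix.vec" assume v: "v \<in> carrier_vec N" "v \<noteq> 0\<^sub>v N"
  have eq: "scalar_prod v (mat_diag N w *\<^sub>v v) = (\<Sum>k\<in>{0..<N}. w k * (vec_index v k)\<^sup>2)"
    using v(1) by (simp add: mat_diag_mult_vec scalar_prod_def power2_eq_square mult_ac)
  obtain k where k: "k < N" "vec_index v k \<noteq> 0"
    using v by (metis carrier_vecD eq_vecI index_zero_vec)
  show "scalar_prod v (mat_diag N w *\<^sub>v v) > 0"
    unfolding eq using k assms
    by (intro sum_pos2[of _ k]) (auto simp: less_imp_le)
qed simp

lemma transpose_mult_mat_diag_mult_entry:
  assumes "A \<in> carrier_mat n N" "k < N" "l < N"
  shows "(transpose_mat A * mat_diag n (w :: nat \<Rightarrow> real) * A) $$ (k, l) = (\<Sum>i\<in>{0..<n}. w i * A $$ (i, k) * A $$ (i, l))"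
  using assms by (subst mat_diag_mult_right[of _ N]) (auto simp: scalar_prod_def mult_ac intro!: sum.cong)

text \<open>Moving the transposed factor to the other side of the scalar product turns R^T B R into
  a quadrature of the extrapolated values on a facet.\<close>

lemma scalar_prod_transpose_mult_mat_diag_mult:
  assumes "A \<in> carrier_mat n N" "u \<in> carrier_vec N" "v \<in> carrier_vec N"
  shows "scalar_prod u ((transpose_mat A * mat_diag n (w :: nat \<Rightarrow> real) * A) *\<^sub>v v)
    = (\<Sum>i\<in>{0..<n}. w i * vec_index (A *\<^sub>v u) i * vec_index (A *\<^sub>v v) i)"
proof -
  have Av: "A *\<^sub>v v \<in> carrier_vec n" and D: "mat_diag n w *\<^sub>v (A *\<^sub>v v) \<in> carrier_vec n"
    using assms by (auto intro: mult_mat_vec_carrier[OF mat_diag_dim])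
  have "scalar_prod u ((transpose_mat A * mat_diag n w * A) *\<^sub>v v)
    = scalar_prod u (transpose_mat A *\<^sub>v (mat_diag n w *\<^sub>v (A *\<^sub>v v)))"
    using assms Av
    by (simp add: assoc_mult_mat_vec[of "transpose_mat A * mat_diag n w" N n A N v]
        assoc_mult_mat_vec[of "transpose_mat A" N n "mat_diag n w" n "A *\<^sub>v v"] mult_carrier_mat[of _ N n])
  also have "\<dots> = scalar_prod (transpose_mat A *\<^sub>v (mat_diag n w *\<^sub>v (A *\<^sub>v v))) u"
    using assms D by (intro comm_scalar_prod[of _ N]) auto
  also have "\<dots> = scalar_prod (mat_diag n w *\<^sub>v (A *\<^sub>v v)) (A *\<^sub>v u)"
    using assms D by (intro transpose_vec_mult_scalar)
  also have "\<dots> = (\<Sum>i\<in>{0..<n}. w i * vec_index (A *\<^sub>v u) i * vec_index (A *\<^sub>v v) i)"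
    using assms Av by (auto simp: mat_diag_mult_vec scalar_prod_def mult_ac intro!: sum.cong)
  finally show ?thesis .
qed

lemma smult_mat_mult_vec:
  fixes A :: "'a :: comm_semiring_0 mat"
  assumes "A \<in> carrier_mat n N" "v \<in> carrier_vec N"
  shows "(c \<cdot>\<^sub>m A) *\<^sub>v v = c \<cdot>\<^sub>v (A *\<^sub>v v)"
  using assms by (intro eq_vecI) (auto simp: scalar_prod_def sum_distrib_left mult_ac)

section \<open>Volume nodes and their ordering\<close>

text \<open>Only the volume rules are fixed here, so that each later lemma names the exactness that
  it asks of the facet rule.\<close>

locale collapsed_quadrature =
  fixes q1 q2 \<tau>1 \<tau>2 :: nat and \<eta>1 \<omega>1 \<eta>2 \<omega>2 :: "nat \<Rightarrow> real" and sg :: "nat \<times> nat \<Rightarrow> nat"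
  assumes distinct1: "inj_on \<eta>1 {0..q1}" and nodes1: "\<And>i. i \<le> q1 \<Longrightarrow> -1 \<le> \<eta>1 i \<and> \<eta>1 i \<le> 1"
    and distinct2: "inj_on \<eta>2 {0..q2}" and nodes2: "\<And>i. i \<le> q2 \<Longrightarrow> -1 \<le> \<eta>2 i \<and> \<eta>2 i < 1"
    and weights1: "\<And>i. i \<le> q1 \<Longrightarrow> \<omega>1 i > 0"
    and weights2: "\<And>i. i \<le> q2 \<Longrightarrow> \<omega>2 i > 0"
    and exact1: "exact_quadrature q1 \<eta>1 \<omega>1 \<tau>1" "2 * q1 \<le> \<tau>1"
    and exact2: "exact_quadrature q2 \<eta>2 \<omega>2 \<tau>2" "2 * q2 \<le> \<tau>2"
    and ordering: "bij_betw sg (multi_indices q1 q2) {..<num_nodes q1 q2}"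
begin

abbreviation "N \<equiv> num_nodes q1 q2"
abbreviation "\<xi> \<equiv> volume_node q1 q2 sg \<eta>1 \<eta>2"
abbreviation "mi \<equiv> multi_index q1 q2 sg"

lemma bij_mi: "bij_betw mi {..<N} (multi_indices q1 q2)"
  unfolding multi_index_def by (rule bij_betw_inv_into[OF ordering])

lemma miE:
  assumes "k < N"
  obtains i j where "mi k = (i, j)" "i \<le> q1" "j \<le> q2"
  using bij_betwE[OF bij_mi] assms by (fastforce simp: multi_indices_def)

lemma mi_eq_iff: "k < N \<Longrightarrow> l < N \<Longrightarrow> mi k = mi l \<longleftrightarrow> k = l"
  using bij_mi by (auto simp: bij_betw_def inj_on_eq_iff)

lemma sum_mi: "(\<Sum>k\<in>{0..<N}. f (mi k)) = (\<Sum>i=0..q1. \<Sum>j=0..q2. f (i, j))"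
proof -
  have "(\<Sum>k\<in>{..<N}. f (mi k)) = sum f (multi_indices q1 q2)"
    by (rule sum.reindex_bij_betw[OF bij_mi])
  then show ?thesis
    by (simp add: multi_indices_def sum.cartesian_product lessThan_atLeast0)
qed

lemma \<xi>_mi: "mi k = (i, j) \<Longrightarrow> \<xi> k = collapsed_map (\<eta>1 i) (\<eta>2 j)"
  by (simp add: volume_node_def)

lemma \<xi>_mi_case: "\<xi> k = (case mi k of (i, j) \<Rightarrow> collapsed_map (\<eta>1 i) (\<eta>2 j))"
  by (simp add: volume_node_def Let_def)

lemma inj_on_\<xi>: "inj_on \<xi> {..<N}"
proof (rule inj_onI)
  fix k l assume kl: "k \<in> {..<N}" "l \<in> {..<N}" and eq: "\<xi> k = \<xi> l"
  obtain a b where k: "mi k = (a, b)" "a \<le> q1" "b \<le> q2" using kl by (auto elim: miE)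
  obtain c d where l: "mi l = (c, d)" "c \<le> q1" "d \<le> q2" using kl by (auto elim: miE)
  have "\<eta>1 a = \<eta>1 c" "\<eta>2 b = \<eta>2 d"
    using collapsed_map_eqD eq nodes2[of b] k l by (force simp: \<xi>_mi)+
  then have "a = c" "b = d" using k l inj_onD[OF distinct1] inj_onD[OF distinct2] by auto
  then show "k = l" using k l kl mi_eq_iff[of k l] by simp
qed

lemma \<xi>_in_ref_triangle: "\<xi> ` {..<N} \<subseteq> ref_triangle"
  using nodes1 nodes2
  by (auto elim!: miE simp: \<xi>_mi less_imp_le intro!: collapsed_map_in_ref_triangle)

lemma multi_mat_mult_nodal_vec:
  assumes "k < N"
  shows "vec_index (multi_mat q1 q2 sg F *\<^sub>v nodal_vec N \<xi> V) k
    = (\<Sum>i=0..q1. \<Sum>j=0..q2. F (mi k) (i, j) * V (collapsed_map (\<eta>1 i) (\<eta>2 j)))"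
proof -
  have "vec_index (multi_mat q1 q2 sg F *\<^sub>v nodal_vec N \<xi> V) k
    = (\<Sum>l\<in>{0..<N}. (\<lambda>\<beta>. F (mi k) \<beta> * V (case \<beta> of (i, j) \<Rightarrow> collapsed_map (\<eta>1 i) (\<eta>2 j))) (mi l))"
    using assms by (auto simp: multi_mat_def nodal_vec_def scalar_prod_def \<xi>_mi_case intro!: sum.cong)
  also have "\<dots> = (\<Sum>i=0..q1. \<Sum>j=0..q2. F (mi k) (i, j) * V (collapsed_map (\<eta>1 i) (\<eta>2 j)))"
    using sum_mi[of "\<lambda>\<beta>. F (mi k) \<beta> * V (case \<beta> of (i, j) \<Rightarrow> collapsed_map (\<eta>1 i) (\<eta>2 j))"] by simp
  finally show ?thesis .
qed

section \<open>Exactness of the derivative matrices\<close>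

text \<open>On the line through a node with fixed second collapsed coordinate, V is a polynomial of
  degree at most \<open>q1\<close>, which Lagrange differentiation handles exactly. The factor 2 /
  (1 - y) inverts the chain rule factor of \<open>collapsed_poly_fst\<close>.\<close>

lemma D1_mat_exact:
  assumes V: "V \<in> poly_space p" and p: "p \<le> q1"
  shows "D1_mat q1 q2 sg \<eta>1 \<eta>2 *\<^sub>v nodal_vec N \<xi> V = nodal_vec N \<xi> (partial_deriv 1 V)"
proof (rule eq_vecI)
  fix k assume "k < dim_vec (nodal_vec N \<xi> (partial_deriv 1 V))"
  then have k: "k < N" by (simp add: nodal_vec_def)
  then obtain a b where ab: "mi k = (a, b)" "a \<le> q1" "b \<le> q2" by (rule miE)
  obtain P where P: "degree P \<le> p" "\<And>x. V (collapsed_map x (\<eta>2 b)) = poly P x"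
    "\<And>x. poly (pderiv P) x = (1 - \<eta>2 b) / 2 * partial_deriv 1 V (collapsed_map x (\<eta>2 b))"
    using collapsed_poly_fst[OF V] by metis
  have "vec_index (D1_mat q1 q2 sg \<eta>1 \<eta>2 *\<^sub>v nodal_vec N \<xi> V) k
    = (\<Sum>i=0..q1. \<Sum>j=0..q2. if j = b then 2 / (1 - \<eta>2 b) * (deriv (lagrange q1 \<eta>1 i) (\<eta>1 a) * poly P (\<eta>1 i)) else 0)"
    unfolding D1_mat_def multi_mat_mult_nodal_vec[OF k] ab
    by (intro sum.cong refl) (auto simp: P(2))
  also have "\<dots> = 2 / (1 - \<eta>2 b) * (\<Sum>i=0..q1. deriv (lagrange q1 \<eta>1 i) (\<eta>1 a) * poly P (\<eta>1 i))"
    using ab by (simp add: sum_distrib_left)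
  also have "\<dots> = 2 / (1 - \<eta>2 b) * poly (pderiv P) (\<eta>1 a)"
    using P(1) p by (subst sum_deriv_lagrange[OF distinct1]) auto
  also have "\<dots> = partial_deriv 1 V (\<xi> k)"
    using nodes2[of b] ab by (simp add: P(3) \<xi>_mi)
  finally show "vec_index (D1_mat q1 q2 sg \<eta>1 \<eta>2 *\<^sub>v nodal_vec N \<xi> V) k
    = vec_index (nodal_vec N \<xi> (partial_deriv 1 V)) k"
    using k by (simp add: nodal_vec_def)
qed (simp add: D1_mat_def multi_mat_def nodal_vec_def)

text \<open>With x the first collapsed coordinate, the first summand of the matrix yields (1 + x) /
  2 times the first partial derivative, and the second yields the second partial derivative minus
  that same term.\<close>

lemma D2_mat_exact:
  assumes V: "V \<in> poly_space p" and p: "p \<le> q1" "p \<le> q2"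
  shows "D2_mat q1 q2 sg \<eta>1 \<eta>2 *\<^sub>v nodal_vec N \<xi> V = nodal_vec N \<xi> (partial_deriv 2 V)"
proof (rule eq_vecI)
  fix k assume "k < dim_vec (nodal_vec N \<xi> (partial_deriv 2 V))"
  then have k: "k < N" by (simp add: nodal_vec_def)
  then obtain a b where ab: "mi k = (a, b)" "a \<le> q1" "b \<le> q2" by (rule miE)
  obtain P where P: "degree P \<le> p" "\<And>x. V (collapsed_map x (\<eta>2 b)) = poly P x"
    "\<And>x. poly (pderiv P) x = (1 - \<eta>2 b) / 2 * partial_deriv 1 V (collapsed_map x (\<eta>2 b))"
    using collapsed_poly_fst[OF V] by metis
  obtain R where R: "degree R \<le> p" "\<And>y. V (collapsed_map (\<eta>1 a) y) = poly R y"
    "\<And>y. poly (pderiv R) y = partial_deriv 2 V (collapsed_map (\<eta>1 a) y)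
      - (1 + \<eta>1 a) / 2 * partial_deriv 1 V (collapsed_map (\<eta>1 a) y)"
    using collapsed_poly_snd[OF V] by metis
  let ?c = "(1 + \<eta>1 a) / (1 - \<eta>2 b)"
  have "vec_index (D2_mat q1 q2 sg \<eta>1 \<eta>2 *\<^sub>v nodal_vec N \<xi> V) k
    = (\<Sum>i=0..q1. \<Sum>j=0..q2.
        (if j = b then ?c * (deriv (lagrange q1 \<eta>1 i) (\<eta>1 a) * poly P (\<eta>1 i)) else 0)
      + (if i = a then deriv (lagrange q2 \<eta>2 j) (\<eta>2 b) * poly R (\<eta>2 j) else 0))"
    unfolding D2_mat_def multi_mat_mult_nodal_vec[OF k] ab
    by (intro sum.cong refl) (auto simp: distrib_right simp flip: P(2) R(2))
  also have "\<dots> = ?c * (\<Sum>i=0..q1. deriv (lagrange q1 \<eta>1 i) (\<eta>1 a) * poly P (\<eta>1 i))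
      + (\<Sum>j=0..q2. deriv (lagrange q2 \<eta>2 j) (\<eta>2 b) * poly R (\<eta>2 j))"
  proof -
    have "(\<Sum>i=0..q1. \<Sum>j=0..q2. if i = a then deriv (lagrange q2 \<eta>2 j) (\<eta>2 b) * poly R (\<eta>2 j) else 0)
      = (\<Sum>j=0..q2. deriv (lagrange q2 \<eta>2 j) (\<eta>2 b) * poly R (\<eta>2 j))"
      using ab by (subst sum.swap) simp
    then show ?thesis using ab by (simp add: sum.distrib sum_distrib_left)
  qed
  also have "\<dots> = ?c * poly (pderiv P) (\<eta>1 a) + poly (pderiv R) (\<eta>2 b)"
    using P(1) R(1) p by (simp add: sum_deriv_lagrange[OF distinct1] sum_deriv_lagrange[OF distinct2])
  also have "\<dots> = partial_deriv 2 V (\<xi> k)"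
    using nodes2[of b] ab by (simp add: P(3) R(3) \<xi>_mi)
  finally show "vec_index (D2_mat q1 q2 sg \<eta>1 \<eta>2 *\<^sub>v nodal_vec N \<xi> V) k
    = vec_index (nodal_vec N \<xi> (partial_deriv 2 V)) k"
    using k by (simp add: nodal_vec_def)
qed (simp add: D2_mat_def multi_mat_def nodal_vec_def)

section \<open>Norm matrix, facet operators and boundary operators\<close>

text \<open>The tensor-product weight times the Jacobian determinant (1 - y) / 2 of the collapsed
  map. It is positive since no volume node lies on the collapsed edge y = 1.\<close>

definition norm_weight :: "nat \<times> nat \<Rightarrow> real" where
  "norm_weight = (\<lambda>(i, j). (1 - \<eta>2 j) / 2 * \<omega>1 i * \<omega>2 j)"

lemma norm_weight_pos: "k < N \<Longrightarrow> norm_weight (mi k) > 0"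
  using nodes2 weights1 weights2 by (auto elim!: miE simp: norm_weight_def)

lemma W_mat_eq: "W_mat q1 q2 sg \<eta>2 \<omega>1 \<omega>2 = mat_diag N (\<lambda>k. norm_weight (mi k))"
  by (rule eq_matI)
    (auto simp: W_mat_def multi_mat_def mat_diag_def norm_weight_def mi_eq_iff split: prod.splits)

text \<open>The pull-back of V has degree at most p in each collapsed coordinate separately, so
  tensor-product interpolation is exact: first in the second coordinate, then in the first.\<close>

lemma R_mat_interp:
  assumes p: "p \<le> q1" "p \<le> q2"
  shows "interp_extrap_op N \<xi> (qf + 1) (facet_node \<eta>f \<zeta>) p (R_mat q1 q2 qf sg \<eta>1 \<eta>2 \<eta>f \<zeta>)"
  unfolding interp_extrap_op_def
proof (intro conjI ballI)
  fix V :: "real^2 \<Rightarrow> real" assume V: "V \<in> poly_space p"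
  have interp: "(\<Sum>i=0..q1. \<Sum>j=0..q2. lagrange q1 \<eta>1 i x * lagrange q2 \<eta>2 j y * V (collapsed_map (\<eta>1 i) (\<eta>2 j)))
    = V (collapsed_map x y)" for x y
  proof -
    have "(\<Sum>j=0..q2. lagrange q2 \<eta>2 j y * V (collapsed_map z (\<eta>2 j))) = V (collapsed_map z y)" for z
    proof -
      obtain P where "degree P \<le> p" "\<And>y. V (collapsed_map z y) = poly P y"
        using collapsed_poly_snd[OF V, of z] by metis
      then show ?thesis using sum_lagrange[OF distinct2, of P] p by simp
    qed
    moreover have "(\<Sum>i=0..q1. lagrange q1 \<eta>1 i x * V (collapsed_map (\<eta>1 i) y)) = V (collapsed_map x y)"
    proof -
      obtain P where "degree P \<le> p" "\<And>x. V (collapsed_map x y) = poly P x"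
        using collapsed_poly_fst[OF V, of y] by metis
      then show ?thesis using sum_lagrange[OF distinct1, of P] p by simp
    qed
    ultimately show ?thesis by (simp add: mult.assoc flip: sum_distrib_left)
  qed
  show "R_mat q1 q2 qf sg \<eta>1 \<eta>2 \<eta>f \<zeta> *\<^sub>v nodal_vec N \<xi> V = nodal_vec (qf + 1) (facet_node \<eta>f \<zeta>) V"
  proof (rule eq_vecI)
    fix k assume "k < dim_vec (nodal_vec (qf + 1) (facet_node \<eta>f \<zeta>) V)"
    then have k: "k < qf + 1" by (simp add: nodal_vec_def)
    \<comment> \<open>The collapsed coordinates of the k-th facet node, which treat the three facets
      at once.\<close>
    define x where "x = (if \<zeta> = 1 then \<eta>f k else if \<zeta> = 2 then 1 else -1)"
    define y where "y = (if \<zeta> = 1 then -1 else \<eta>f k)"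
    have "vec_index (R_mat q1 q2 qf sg \<eta>1 \<eta>2 \<eta>f \<zeta> *\<^sub>v nodal_vec N \<xi> V) k
      = (\<Sum>l\<in>{0..<N}. (\<lambda>(i, j). lagrange q1 \<eta>1 i x * lagrange q2 \<eta>2 j y * V (collapsed_map (\<eta>1 i) (\<eta>2 j))) (mi l))"
      using k by (auto simp: R_mat_def nodal_vec_def scalar_prod_def \<xi>_mi_case x_def y_def
          split: prod.splits intro!: sum.cong)
    also have "\<dots> = V (collapsed_map x y)"
      unfolding sum_mi by (simp add: interp)
    finally show "vec_index (R_mat q1 q2 qf sg \<eta>1 \<eta>2 \<eta>f \<zeta> *\<^sub>v nodal_vec N \<xi> V) k
      = vec_index (nodal_vec (qf + 1) (facet_node \<eta>f \<zeta>) V) k"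
      using k by (simp add: nodal_vec_def facet_node_def x_def y_def)
  qed (simp add: R_mat_def nodal_vec_def)
qed (simp add: R_mat_def)

lemma R_mat_carrier: "R_mat q1 q2 qf sg \<eta>1 \<eta>2 \<eta>f \<zeta> \<in> carrier_mat (qf + 1) N"
  by (simp add: R_mat_def)

lemma B_mat_eq: "B_mat qf \<omega>f \<zeta> = mat_diag (qf + 1) (facet_weight \<omega>f \<zeta>)"
  by (rule eq_matI) (auto simp: B_mat_def mat_diag_def)

lemma facet_term_carrier: "facet_term q1 q2 qf sg \<eta>1 \<eta>2 \<eta>f \<omega>f m \<zeta> \<in> carrier_mat N N"
  by (auto simp: facet_term_def Let_def R_mat_def)

lemma E_mat_carrier: "E_mat q1 q2 qf sg \<eta>1 \<eta>2 \<eta>f \<omega>f m \<in> carrier_mat N N"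
  unfolding E_mat_def by (intro add_carrier_mat facet_term_carrier)

text \<open>One collapsed coordinate is constant on each facet, so its Lagrange factors leave the
  quadrature sum and a one-dimensional mass matrix entry remains.\<close>

lemma facet_term_entry:
  assumes "k < N" "l < N" "mi k = (a, b)" "mi l = (c, d)"
  shows "facet_term q1 q2 qf sg \<eta>1 \<eta>2 \<eta>f \<omega>f m \<zeta> $$ (k, l) = facet_normal \<zeta> $ m *
    (if \<zeta> = 1 then (\<Sum>i=0..qf. \<omega>f i * lagrange q1 \<eta>1 a (\<eta>f i) * lagrange q1 \<eta>1 c (\<eta>f i))
        * (lagrange q2 \<eta>2 b (-1) * lagrange q2 \<eta>2 d (-1))
     else if \<zeta> = 2 then sqrt 2 * (\<Sum>i=0..qf. \<omega>f i * lagrange q2 \<eta>2 b (\<eta>f i) * lagrange q2 \<eta>2 d (\<eta>f i))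
        * (lagrange q1 \<eta>1 a 1 * lagrange q1 \<eta>1 c 1)
     else (\<Sum>i=0..qf. \<omega>f i * lagrange q2 \<eta>2 b (\<eta>f i) * lagrange q2 \<eta>2 d (\<eta>f i))
        * (lagrange q1 \<eta>1 a (-1) * lagrange q1 \<eta>1 c (-1)))"
proof -
  let ?R = "R_mat q1 q2 qf sg \<eta>1 \<eta>2 \<eta>f \<zeta>"
  have "facet_term q1 q2 qf sg \<eta>1 \<eta>2 \<eta>f \<omega>f m \<zeta> $$ (k, l)
    = facet_normal \<zeta> $ m * (transpose_mat ?R * mat_diag (qf + 1) (facet_weight \<omega>f \<zeta>) * ?R) $$ (k, l)"
    using assms carrier_matD[OF R_mat_carrier] by (simp add: facet_term_def Let_def B_mat_eq)
  also have "\<dots> = facet_normal \<zeta> $ m * (\<Sum>i=0..qf. facet_weight \<omega>f \<zeta> i * ?R $$ (i, k) * ?R $$ (i, l))"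
    unfolding transpose_mult_mat_diag_mult_entry[OF R_mat_carrier assms(1,2)]
    by (simp add: atLeastLessThanSuc_atLeastAtMost)
  finally show ?thesis
    using assms by (simp add: R_mat_def facet_weight_def sum_distrib_left sum_distrib_right mult_ac)
qed

text \<open>Since R is exact on U and V, each facet term is the facet quadrature of their product.
  That product has degree at most 2 p along the facet, so the quadrature equals the boundary
  integral.\<close>

lemma scalar_prod_E_mat:
  fixes U V :: "real^2 \<Rightarrow> real"
  assumes UV: "U \<in> poly_space p" "V \<in> poly_space p" and p: "p \<le> q1" "p \<le> q2"
    and exactf: "exact_quadrature qf \<eta>f \<omega>f \<tau>f" and \<tau>f: "2 * p \<le> \<tau>f"
  shows "scalar_prod (nodal_vec N \<xi> U) (E_mat q1 q2 qf sg \<eta>1 \<eta>2 \<eta>f \<omega>f m *\<^sub>v nodal_vec N \<xi> V)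
    = ref_boundary_integral (\<lambda>x. U x * V x * (ref_normal x $ m))"
proof -
  have carr: "nodal_vec N \<xi> F \<in> carrier_vec N" for F by (simp add: nodal_vec_def)
  have "scalar_prod (nodal_vec N \<xi> U) (facet_term q1 q2 qf sg \<eta>1 \<eta>2 \<eta>f \<omega>f m \<zeta> *\<^sub>v nodal_vec N \<xi> V)
    = arclength_integral (facet_path \<zeta>) (\<lambda>x. U x * V x * (ref_normal x $ m))" for \<zeta>
  proof -
    let ?R = "R_mat q1 q2 qf sg \<eta>1 \<eta>2 \<eta>f \<zeta>"
    obtain P where P: "degree P \<le> p" "\<And>s. U (facet_point \<zeta> s) = poly P s" using facet_poly[OF UV(1)] by metis
    obtain S where S: "degree S \<le> p" "\<And>s. V (facet_point \<zeta> s) = poly S s" using facet_poly[OF UV(2)] by metis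
    have deg: "degree (P * S) \<le> \<tau>f" using degree_mult_le[of P S] P(1) S(1) \<tau>f by linarith
    let ?M = "transpose_mat ?R * mat_diag (qf + 1) (facet_weight \<omega>f \<zeta>) * ?R"
    have M: "?M \<in> carrier_mat N N"
      by (intro mult_carrier_mat[of _ N "qf + 1"]) (auto intro: R_mat_carrier simp: R_mat_def)
    have "scalar_prod (nodal_vec N \<xi> U) (facet_term q1 q2 qf sg \<eta>1 \<eta>2 \<eta>f \<omega>f m \<zeta> *\<^sub>v nodal_vec N \<xi> V)
      = facet_normal \<zeta> $ m * scalar_prod (nodal_vec N \<xi> U) (?M *\<^sub>v nodal_vec N \<xi> V)"
    proof -
      show ?thesis
        using scalar_prod_smult_distrib[OF carr mult_mat_vec_carrier[OF M carr]] smult_mat_mult_vec[OF M carr]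
        by (simp add: facet_term_def Let_def B_mat_eq)
    qed
    also have "scalar_prod (nodal_vec N \<xi> U) (?M *\<^sub>v nodal_vec N \<xi> V)
      = (\<Sum>i=0..qf. facet_weight \<omega>f \<zeta> i * U (facet_node \<eta>f \<zeta> i) * V (facet_node \<eta>f \<zeta> i))"
    proof -
      have "?R *\<^sub>v nodal_vec N \<xi> F = nodal_vec (qf + 1) (facet_node \<eta>f \<zeta>) F" if "F \<in> poly_space p" for F
        using R_mat_interp[OF p] that by (simp add: interp_extrap_op_def)
      then show ?thesis
        unfolding scalar_prod_transpose_mult_mat_diag_mult[OF R_mat_carrier carr carr]
        by (simp add: UV nodal_vec_def atLeastLessThanSuc_atLeastAtMost)
    qed
    also have "\<dots> = (if \<zeta> = 2 then sqrt 2 else 1) * (\<Sum>i=0..qf. poly (P * S) (\<eta>f i) * \<omega>f i)"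
      by (simp add: facet_node_eq P(2) S(2) facet_weight_def sum_distrib_left mult_ac)
    also have "facet_normal \<zeta> $ m * \<dots> = arclength_integral (facet_path \<zeta>) (\<lambda>x. U x * V x * (ref_normal x $ m))"
      unfolding exact_quadratureD[OF exactf deg]
      by (subst arclength_integral_facet[where P = "P * S"]) (simp_all add: P(2) S(2))
    finally show ?thesis .
  qed
  moreover have expand: "scalar_prod u ((A1 + A2 + A3) *\<^sub>v v)
      = scalar_prod u (A1 *\<^sub>v v) + scalar_prod u (A2 *\<^sub>v v) + scalar_prod u (A3 *\<^sub>v v)"
    if "A1 \<in> carrier_mat N N" "A2 \<in> carrier_mat N N" "A3 \<in> carrier_mat N N" "u \<in> carrier_vec N" "v \<in> carrier_vec N"
    for A1 A2 A3 :: "real mat" and u v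
    using that
    by (simp add: add_mult_distrib_mat_vec[of _ N N] scalar_prod_add_distrib[of _ N])
  ultimately show ?thesis
    unfolding E_mat_def ref_boundary_integral_def sum_3
      expand[OF facet_term_carrier facet_term_carrier facet_term_carrier carr carr] by simp
qed

section \<open>The summation-by-parts property\<close>

lemma facet_mass1:
  assumes "exact_quadrature qf \<eta>f \<omega>f \<tau>f" "2 * q1 \<le> \<tau>f" "a \<le> q1" "c \<le> q1"
  shows "(\<Sum>i=0..qf. \<omega>f i * lagrange q1 \<eta>1 a (\<eta>f i) * lagrange q1 \<eta>1 c (\<eta>f i)) = (if a = c then \<omega>1 a else 0)"
  using facet_mass_matrix[OF exact1 distinct1 assms(3,4,1,2)] .

lemma facet_mass2:
  assumes "exact_quadrature qf \<eta>f \<omega>f \<tau>f" "2 * q2 \<le> \<tau>f" "b \<le> q2" "d \<le> q2"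
  shows "(\<Sum>i=0..qf. \<omega>f i * lagrange q2 \<eta>2 b (\<eta>f i) * lagrange q2 \<eta>2 d (\<eta>f i)) = (if b = d then \<omega>2 b else 0)"
  using facet_mass_matrix[OF exact2 distinct2 assms(3,4,1,2)] .

lemma W_mult_entry:
  assumes "k < N" "l < N"
  shows "(W_mat q1 q2 sg \<eta>2 \<omega>1 \<omega>2 * multi_mat q1 q2 sg F) $$ (k, l) = norm_weight (mi k) * F (mi k) (mi l)"
  using assms unfolding W_mat_eq
  by (subst mat_diag_mult_left[of _ N N]) (auto simp: multi_mat_def)

lemma E_mat_entry:
  assumes "k < N" "l < N"
  shows "E_mat q1 q2 qf sg \<eta>1 \<eta>2 \<eta>f \<omega>f m $$ (k, l) = (\<Sum>\<zeta>\<in>UNIV. facet_term q1 q2 qf sg \<eta>1 \<eta>2 \<eta>f \<omega>f m \<zeta> $$ (k, l))"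
  using assms carrier_matD[OF facet_term_carrier] by (simp add: E_mat_def sum_3)

text \<open>Integration by parts in the first collapsed coordinate leaves its endpoints 1 and -1,
  which are facets 2 and 3; their mass matrices supply the weights of the second coordinate. On
  facet 2 the normal component 1 / sqrt 2 cancels the sqrt 2 of the facet weights, and on facet 1
  the normal component is 0.\<close>

lemma W_D1_plus_transpose:
  assumes exactf: "exact_quadrature qf \<eta>f \<omega>f \<tau>f" "2 * q2 \<le> \<tau>f"
  defines "Q \<equiv> W_mat q1 q2 sg \<eta>2 \<omega>1 \<omega>2 * D1_mat q1 q2 sg \<eta>1 \<eta>2"
  shows "Q + transpose_mat Q = E_mat q1 q2 qf sg \<eta>1 \<eta>2 \<eta>f \<omega>f 1"
proof (rule eq_matI)
  have dim: "dim_row Q = N" "dim_col Q = N"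
    by (simp_all add: Q_def W_mat_def D1_mat_def multi_mat_def)
  note dimE = carrier_matD[OF E_mat_carrier]
  show "dim_row (Q + transpose_mat Q) = dim_row (E_mat q1 q2 qf sg \<eta>1 \<eta>2 \<eta>f \<omega>f 1)"
    "dim_col (Q + transpose_mat Q) = dim_col (E_mat q1 q2 qf sg \<eta>1 \<eta>2 \<eta>f \<omega>f 1)"
    by (simp_all add: dim dimE)
  fix k l assume "k < dim_row (E_mat q1 q2 qf sg \<eta>1 \<eta>2 \<eta>f \<omega>f 1)"
    "l < dim_col (E_mat q1 q2 qf sg \<eta>1 \<eta>2 \<eta>f \<omega>f 1)"
  then have kl: "k < N" "l < N" by (simp_all add: dimE)
  obtain a b where ab: "mi k = (a, b)" "a \<le> q1" "b \<le> q2" using kl by (auto elim: miE)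
  obtain c d where cd: "mi l = (c, d)" "c \<le> q1" "d \<le> q2" using kl by (auto elim: miE)
  have ne: "1 - \<eta>2 b \<noteq> 0" "1 - \<eta>2 d \<noteq> 0" using nodes2[of b] nodes2[of d] ab cd by auto
  have Q: "Q $$ (k, l) = (if b = d then \<omega>2 b * (\<omega>1 a * deriv (lagrange q1 \<eta>1 c) (\<eta>1 a)) else 0)"
    "Q $$ (l, k) = (if b = d then \<omega>2 b * (\<omega>1 c * deriv (lagrange q1 \<eta>1 a) (\<eta>1 c)) else 0)"
    using kl ab cd ne unfolding Q_def D1_mat_def by (simp_all add: W_mult_entry norm_weight_def)
  have "(Q + transpose_mat Q) $$ (k, l) = Q $$ (k, l) + Q $$ (l, k)"
    using kl by (simp add: dim)
  also have "\<dots> = (if b = d then \<omega>2 b else 0)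
      * (\<omega>1 a * deriv (lagrange q1 \<eta>1 c) (\<eta>1 a) + \<omega>1 c * deriv (lagrange q1 \<eta>1 a) (\<eta>1 c))"
    unfolding Q by (simp add: distrib_left)
  \<comment> \<open>This is the case g = 1, where no mass matrix term appears.\<close>
  also have "\<dots> = (if b = d then \<omega>2 b else 0)
      * (lagrange q1 \<eta>1 a 1 * lagrange q1 \<eta>1 c 1 - lagrange q1 \<eta>1 a (-1) * lagrange q1 \<eta>1 c (-1))"
    using quadrature_by_parts[OF exact1 distinct1 ab(2) cd(2), of 1 0] by simp
  also have "\<dots> = E_mat q1 q2 qf sg \<eta>1 \<eta>2 \<eta>f \<omega>f 1 $$ (k, l)"
    unfolding E_mat_entry[OF kl] facet_term_entry[OF kl ab(1) cd(1)]
      facet_mass2[OF exactf ab(3) cd(3)]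
    by (simp add: sum_3 facet_normal_def right_diff_distrib)
  finally show "(Q + transpose_mat Q) $$ (k, l) = E_mat q1 q2 qf sg \<eta>1 \<eta>2 \<eta>f \<omega>f 1 $$ (k, l)" .
qed

text \<open>Here e and f stand for the Kronecker deltas of \<open>D2_mat\<close>, x and y for the
  derivatives of the Lagrange polynomials. What remains are the one-dimensional terms of
  \<open>quadrature_by_parts\<close> with g = 1 + x and g = 1 - x.\<close>

lemma norm_weight_mult:
  assumes "j \<le> q2"
  shows "norm_weight (i, j) * ((1 + \<eta>1 i) / (1 - \<eta>2 j) * x * e + f * y)
    = e * \<omega>2 j * ((1 + \<eta>1 i) * \<omega>1 i * x) / 2 + f * \<omega>1 i * ((1 - \<eta>2 j) * \<omega>2 j * y) / 2"
proof -
  define s where "s = 1 - \<eta>2 j"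
  have "s \<noteq> 0" "\<eta>2 j = 1 - s" using nodes2[OF assms] by (auto simp: s_def)
  then show ?thesis by (simp add: norm_weight_def field_simps)
qed

text \<open>The function 1 + x vanishes at -1 and 1 - x vanishes at 1, so only facets 2 and 1
  survive, as the second normal component on facet 3 is 0. The value 2 at the other endpoint cancels
  the halves from the weight.\<close>

lemma W_D2_plus_transpose:
  assumes exactf: "exact_quadrature qf \<eta>f \<omega>f \<tau>f" "2 * q1 \<le> \<tau>f" "2 * q2 \<le> \<tau>f"
  defines "Q \<equiv> W_mat q1 q2 sg \<eta>2 \<omega>1 \<omega>2 * D2_mat q1 q2 sg \<eta>1 \<eta>2"
  shows "Q + transpose_mat Q = E_mat q1 q2 qf sg \<eta>1 \<eta>2 \<eta>f \<omega>f 2"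
proof (rule eq_matI)
  have dim: "dim_row Q = N" "dim_col Q = N"
    by (simp_all add: Q_def W_mat_def D2_mat_def multi_mat_def)
  note dimE = carrier_matD[OF E_mat_carrier]
  show "dim_row (Q + transpose_mat Q) = dim_row (E_mat q1 q2 qf sg \<eta>1 \<eta>2 \<eta>f \<omega>f 2)"
    "dim_col (Q + transpose_mat Q) = dim_col (E_mat q1 q2 qf sg \<eta>1 \<eta>2 \<eta>f \<omega>f 2)"
    by (simp_all add: dim dimE)
  fix k l assume "k < dim_row (E_mat q1 q2 qf sg \<eta>1 \<eta>2 \<eta>f \<omega>f 2)"
    "l < dim_col (E_mat q1 q2 qf sg \<eta>1 \<eta>2 \<eta>f \<omega>f 2)"
  then have kl: "k < N" "l < N" by (simp_all add: dimE)
  obtain a b where ab: "mi k = (a, b)" "a \<le> q1" "b \<le> q2" using kl by (auto elim: miE)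
  obtain c d where cd: "mi l = (c, d)" "c \<le> q1" "d \<le> q2" using kl by (auto elim: miE)
  let ?m1 = "if a = c then \<omega>1 a else 0" and ?m2 = "if b = d then \<omega>2 b else 0"
  \<comment> \<open>The factors are written as 1 + 1 * x and 1 + (-1) * x to match
    \<open>quadrature_by_parts\<close> literally. In the transposed entry the Kronecker deltas allow
    the weights at d and c to be replaced by those at b and a.\<close>
  have Q: "Q $$ (k, l) = ?m2 * ((1 + 1 * \<eta>1 a) * \<omega>1 a * deriv (lagrange q1 \<eta>1 c) (\<eta>1 a)) / 2
      + ?m1 * ((1 + (-1) * \<eta>2 b) * \<omega>2 b * deriv (lagrange q2 \<eta>2 d) (\<eta>2 b)) / 2"
    "Q $$ (l, k) = ?m2 * ((1 + 1 * \<eta>1 c) * \<omega>1 c * deriv (lagrange q1 \<eta>1 a) (\<eta>1 c)) / 2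
      + ?m1 * ((1 + (-1) * \<eta>2 d) * \<omega>2 d * deriv (lagrange q2 \<eta>2 b) (\<eta>2 d)) / 2"
    unfolding Q_def D2_mat_def W_mult_entry[OF kl] W_mult_entry[OF kl(2,1)] ab(1) cd(1) prod.case
      norm_weight_mult[OF ab(3)] norm_weight_mult[OF cd(3)] by auto
  have "(Q + transpose_mat Q) $$ (k, l) = Q $$ (k, l) + Q $$ (l, k)"
    using kl by (simp add: dim)
  also have "\<dots> = ?m2 * ((1 + 1 * \<eta>1 a) * \<omega>1 a * deriv (lagrange q1 \<eta>1 c) (\<eta>1 a)
        + (1 + 1 * \<eta>1 c) * \<omega>1 c * deriv (lagrange q1 \<eta>1 a) (\<eta>1 c)) / 2
      + ?m1 * ((1 + (-1) * \<eta>2 b) * \<omega>2 b * deriv (lagrange q2 \<eta>2 d) (\<eta>2 b)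
        + (1 + (-1) * \<eta>2 d) * \<omega>2 d * deriv (lagrange q2 \<eta>2 b) (\<eta>2 d)) / 2"
    unfolding Q distrib_left[of "?m1"] distrib_left[of "?m2"] add_divide_distrib by (simp only: add_ac)
  also have "\<dots> = ?m2 * (2 * (lagrange q1 \<eta>1 a 1 * lagrange q1 \<eta>1 c 1) - ?m1) / 2
      + ?m1 * (- 2 * (lagrange q2 \<eta>2 b (-1) * lagrange q2 \<eta>2 d (-1)) + ?m2) / 2"
    unfolding quadrature_by_parts[OF exact1 distinct1 ab(2) cd(2)]
      quadrature_by_parts[OF exact2 distinct2 ab(3) cd(3)] by simp
  \<comment> \<open>The slopes 1 and -1 of the two functions g produce mass matrix products of
    opposite sign, which cancel.\<close>
  also have "\<dots> = ?m2 * (lagrange q1 \<eta>1 a 1 * lagrange q1 \<eta>1 c 1)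
      - ?m1 * (lagrange q2 \<eta>2 b (-1) * lagrange q2 \<eta>2 d (-1))"
    by (simp add: field_simps)
  also have "\<dots> = E_mat q1 q2 qf sg \<eta>1 \<eta>2 \<eta>f \<omega>f 2 $$ (k, l)"
    unfolding E_mat_entry[OF kl] facet_term_entry[OF kl ab(1) cd(1)]
      facet_mass1[OF exactf(1,2) ab(2) cd(2)] facet_mass2[OF exactf(1,3) ab(3) cd(3)]
    by (simp add: sum_3 facet_normal_def)
  finally show "(Q + transpose_mat Q) $$ (k, l) = E_mat q1 q2 qf sg \<eta>1 \<eta>2 \<eta>f \<omega>f 2 $$ (k, l)" .
qed

section \<open>Assembly of the SBP operators\<close>

lemma W_mat_inverse:
  obtains Winv where "Winv \<in> carrier_mat N N" "W_mat q1 q2 sg \<eta>2 \<omega>1 \<omega>2 * Winv = 1\<^sub>m N"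
    "Winv * W_mat q1 q2 sg \<eta>2 \<omega>1 \<omega>2 = 1\<^sub>m N"
proof
  let ?Winv = "mat_diag N (\<lambda>k. 1 / norm_weight (mi k))"
  show "?Winv \<in> carrier_mat N N" by simp
  have ne: "norm_weight (mi k) \<noteq> 0" if "k < N" for k using norm_weight_pos[OF that] by simp
  then have "mat_diag N (\<lambda>k. norm_weight (mi k) * (1 / norm_weight (mi k))) = 1\<^sub>m N"
    "mat_diag N (\<lambda>k. 1 / norm_weight (mi k) * norm_weight (mi k)) = 1\<^sub>m N"
    by (auto simp: mat_diag_def intro!: eq_matI)
  then show "W_mat q1 q2 sg \<eta>2 \<omega>1 \<omega>2 * ?Winv = 1\<^sub>m N" "?Winv * W_mat q1 q2 sg \<eta>2 \<omega>1 \<omega>2 = 1\<^sub>m N"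
    by (simp_all add: W_mat_eq)
qed

text \<open>With Q = W D, only the exactness of D and Q + Q^T = E depend on the direction m. The
  boundary accuracy is obtained with r = p.\<close>

lemma diagonal_norm_nodal_SBP_I:
  assumes D: "D \<in> carrier_mat N N"
    and exact: "\<And>V. V \<in> poly_space p \<Longrightarrow> D *\<^sub>v nodal_vec N \<xi> V = nodal_vec N \<xi> (partial_deriv m V)"
    and SBP: "W_mat q1 q2 sg \<eta>2 \<omega>1 \<omega>2 * D + transpose_mat (W_mat q1 q2 sg \<eta>2 \<omega>1 \<omega>2 * D)
      = E_mat q1 q2 qf sg \<eta>1 \<eta>2 \<eta>f \<omega>f m"
    and p: "p \<le> q1" "p \<le> q2"
    and exactf: "exact_quadrature qf \<eta>f \<omega>f \<tau>f" "2 * p \<le> \<tau>f"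
  shows "diagonal_norm_nodal_SBP ref_triangle ref_boundary_integral ref_normal N \<xi> m p
    D (W_mat q1 q2 sg \<eta>2 \<omega>1 \<omega>2) (E_mat q1 q2 qf sg \<eta>1 \<eta>2 \<eta>f \<omega>f m)"
  unfolding diagonal_norm_nodal_SBP_def nodal_SBP_def
proof (intro conjI ballI)
  let ?W = "W_mat q1 q2 sg \<eta>2 \<omega>1 \<omega>2"
  have W: "?W \<in> carrier_mat N N" by (simp add: W_mat_eq)
  show "sym_pos_def_mat N ?W"
    unfolding W_mat_eq by (rule sym_pos_def_mat_diag) (rule norm_weight_pos)
  show "diagonal_mat ?W"
    unfolding W_mat_eq by (simp add: diagonal_mat_def mat_diag_def)
  obtain Winv where Winv: "Winv \<in> carrier_mat N N" "?W * Winv = 1\<^sub>m N" "Winv * ?W = 1\<^sub>m N"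
    by (rule W_mat_inverse)
  have "D = Winv * (?W * D)"
    using Winv W D by (simp flip: assoc_mult_mat[of Winv N N ?W N D N])
  then show "\<exists>Winv\<in>carrier_mat N N. \<exists>Q\<in>carrier_mat N N. inverts_mat ?W Winv \<and> inverts_mat Winv ?W \<and>
      D = Winv * Q \<and> Q + transpose_mat Q = E_mat q1 q2 qf sg \<eta>1 \<eta>2 \<eta>f \<omega>f m"
    using Winv W D SBP by (intro bexI[of _ Winv] bexI[of _ "?W * D"]) (auto simp: inverts_mat_def)
  show "\<exists>r\<ge>p. \<forall>U\<in>poly_space r. \<forall>V\<in>poly_space r.
      scalar_prod (nodal_vec N \<xi> U) (E_mat q1 q2 qf sg \<eta>1 \<eta>2 \<eta>f \<omega>f m *\<^sub>v nodal_vec N \<xi> V)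
      = ref_boundary_integral (\<lambda>x. U x * V x * (ref_normal x $ m))"
    using scalar_prod_E_mat[OF _ _ p exactf] by blast
qed (simp_all add: D exact compact_ref_triangle connected_ref_triangle inj_on_\<xi> E_mat_carrier
    \<xi>_in_ref_triangle)

end

theorem theorem3p2:
  fixes q1 q2 qf q N \<tau>1 \<tau>2 \<tau>f :: nat
    and \<eta>1 \<omega>1 \<eta>2 \<omega>2 \<eta>f \<omega>f :: "nat \<Rightarrow> real"
    and sg :: "nat \<times> nat \<Rightarrow> nat"
    and \<xi> :: "nat \<Rightarrow> real^2"
  assumes q: "q = min q1 q2"
    and N: "N = num_nodes q1 q2"
    and distinct1: "inj_on \<eta>1 {0..q1}" and nodes1: "\<And>i. i \<le> q1 \<Longrightarrow> -1 \<le> \<eta>1 i \<and> \<eta>1 i \<le> 1"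
    and distinct2: "inj_on \<eta>2 {0..q2}" and nodes2: "\<And>i. i \<le> q2 \<Longrightarrow> -1 \<le> \<eta>2 i \<and> \<eta>2 i < 1"
    and weights1: "\<And>i. i \<le> q1 \<Longrightarrow> \<omega>1 i > 0"
    and weights2: "\<And>i. i \<le> q2 \<Longrightarrow> \<omega>2 i > 0"
    and gaussian1: "gaussian_rule q1 \<eta>1 \<omega>1"
    and gaussian2: "gaussian_rule q2 \<eta>2 \<omega>2"
    and nodesf: "\<And>i. i \<le> qf \<Longrightarrow> -1 \<le> \<eta>f i \<and> \<eta>f i \<le> 1"
    and weightsf: "\<And>i. i \<le> qf \<Longrightarrow> \<omega>f i \<ge> 0"
    and exact1: "exact_quadrature q1 \<eta>1 \<omega>1 \<tau>1" and \<tau>1: "\<tau>1 \<ge> 2 * q1"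
    and exact2: "exact_quadrature q2 \<eta>2 \<omega>2 \<tau>2" and \<tau>2: "\<tau>2 \<ge> 2 * q2"
    and exactf: "exact_quadrature qf \<eta>f \<omega>f \<tau>f" and \<tau>f: "\<tau>f \<ge> 2 * max q1 q2"
    and ordering: "bij_betw sg (multi_indices q1 q2) {..<N}"
    and \<xi>: "\<xi> = volume_node q1 q2 sg \<eta>1 \<eta>2"
  shows
    "diagonal_norm_nodal_SBP ref_triangle ref_boundary_integral ref_normal N \<xi> 1 q
       (D1_mat q1 q2 sg \<eta>1 \<eta>2) (W_mat q1 q2 sg \<eta>2 \<omega>1 \<omega>2)
       (E_mat q1 q2 qf sg \<eta>1 \<eta>2 \<eta>f \<omega>f 1) \<and>
     diagonal_norm_nodal_SBP ref_triangle ref_boundary_integral ref_normal N \<xi> 2 q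
       (D2_mat q1 q2 sg \<eta>1 \<eta>2) (W_mat q1 q2 sg \<eta>2 \<omega>1 \<omega>2)
       (E_mat q1 q2 qf sg \<eta>1 \<eta>2 \<eta>f \<omega>f 2) \<and>
     (\<forall>\<zeta> :: 3. \<exists>r \<ge> q.
        interp_extrap_op N \<xi> (qf + 1) (facet_node \<eta>f \<zeta>) r (R_mat q1 q2 qf sg \<eta>1 \<eta>2 \<eta>f \<zeta>))"
proof -
  interpret collapsed_quadrature q1 q2 \<tau>1 \<tau>2 \<eta>1 \<omega>1 \<eta>2 \<omega>2 sg
    using distinct1 nodes1 distinct2 nodes2 weights1 weights2 exact1 \<tau>1 exact2 \<tau>2 ordering
    unfolding N by unfold_locales auto
  \<comment> \<open>The minimum lets degree q fit both one-dimensional bases. The maximum makes the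
    facet rule exact for both mass matrices, and for products of two polynomials of degree q on a
    facet.\<close>
  have le: "q \<le> q1" "q \<le> q2" "2 * q1 \<le> \<tau>f" "2 * q2 \<le> \<tau>f" "2 * q \<le> \<tau>f"
    using q \<tau>f by auto
  have D: "D1_mat q1 q2 sg \<eta>1 \<eta>2 \<in> carrier_mat N N" "D2_mat q1 q2 sg \<eta>1 \<eta>2 \<in> carrier_mat N N"
    by (simp_all add: D1_mat_def D2_mat_def multi_mat_def N)
  show ?thesis
    unfolding N \<xi>
  proof (intro conjI allI)
    show "diagonal_norm_nodal_SBP ref_triangle ref_boundary_integral ref_normal (num_nodes q1 q2)
        (volume_node q1 q2 sg \<eta>1 \<eta>2) 1 q (D1_mat q1 q2 sg \<eta>1 \<eta>2) (W_mat q1 q2 sg \<eta>2 \<omega>1 \<omega>2)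
        (E_mat q1 q2 qf sg \<eta>1 \<eta>2 \<eta>f \<omega>f 1)"
      using D(1) le unfolding N
      by (intro diagonal_norm_nodal_SBP_I[OF _ D1_mat_exact W_D1_plus_transpose[OF exactf] _ _ exactf]) auto
    show "diagonal_norm_nodal_SBP ref_triangle ref_boundary_integral ref_normal (num_nodes q1 q2)
        (volume_node q1 q2 sg \<eta>1 \<eta>2) 2 q (D2_mat q1 q2 sg \<eta>1 \<eta>2) (W_mat q1 q2 sg \<eta>2 \<omega>1 \<omega>2)
        (E_mat q1 q2 qf sg \<eta>1 \<eta>2 \<eta>f \<omega>f 2)"
      using D(2) le unfolding N
      by (intro diagonal_norm_nodal_SBP_I[OF _ D2_mat_exact W_D2_plus_transpose[OF exactf] _ _ exactf]) auto
    show "\<exists>r\<ge>q. interp_extrap_op (num_nodes q1 q2) (volume_node q1 q2 sg \<eta>1 \<eta>2) (qf + 1)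
        (facet_node \<eta>f \<zeta>) r (R_mat q1 q2 qf sg \<eta>1 \<eta>2 \<eta>f \<zeta>)" for \<zeta>
      using R_mat_interp[OF le(1,2)] by blast
  qed
qed

end
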